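(* Let $\alpha\in(0,2)$, let $\mathcal{P}=-\frac{d}{dx}\left(x^\alpha\frac{d}{dx}\right)$ be the degenerate operator on $L^2(0,1)$ with domain $D(\mathcal{P})$ given in the context, with eigenvalues $\lambda_j$ and orthonormal eigenfunctions $\Phi_j$, $j\ge 1$. Let $\omega$ be an open and nonempty subset of $(0,1)$. If $\alpha\neq 1$, put $\sigma=3/4$; if $\alpha=1$, put $\sigma=3/(2\gamma)$, where $\gamma$ is any number in $(0,2)$ for which $3/(2\gamma)\in(0,1)$. Then there exists a constant $C>0$ such that $$\sum_{\lambda_j\le\Lambda}|a_j|^2\le Ce^{C\Lambda^\sigma}\int_\omega\Big|\sum_{\lambda_j\le\Lambda}a_j\Phi_j(x)\Big|^2dx$$ for all real numbers $a_j$ and all $\Lambda>0$.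
   Context: For $\alpha\in(0,2)$ let $H^1_\alpha(0,1)$ be the set of $\vartheta\in L^2(0,1)$ that are (locally) absolutely continuous in $(0,1)$ with $\int_0^1x^\alpha|\vartheta'|^2dx<\infty$ and $\vartheta(1)=0$. Let $\mathrm{BC}_\alpha(\vartheta)=\vartheta|_{x=0}$ if $\alpha\in(0,1)$ and $\mathrm{BC}_\alpha(\vartheta)=(x^\alpha\vartheta')|_{x=0}$ if $\alpha\in[1,2)$. The operator $\mathcal{P}\vartheta=-(x^\alpha\vartheta')'$ has domain $D(\mathcal{P})=\{\vartheta\in H^1_\alpha(0,1):\ \mathcal{P}\vartheta\in L^2(0,1),\ \mathrm{BC}_\alpha(\vartheta)=0\}$. It is self-adjoint, positive, densely defined, with compact resolvent; $\{\Phi_j\}_{j\ge1}$ is a Hilbert (orthonormal) basis of $L^2(0,1)$ with $\mathcal{P}\Phi_j=\lambda_j\Phi_j$ and $0<\lambda_1\le\lambda_2\le\dots\to+\infty$. *)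

theory Defs
  imports "HOL-Analysis.Analysis"
begin

definition absolutely_continuous_on :: "real set \<Rightarrow> (real \<Rightarrow> real) \<Rightarrow> bool" where
  "absolutely_continuous_on S f \<longleftrightarrow>
     (\<forall>\<epsilon>>0. \<exists>\<delta>>0. \<forall>(n::nat) u v.
        (\<forall>k<n. u k \<in> S \<and> v k \<in> S \<and> u k \<le> v k) \<and>
        (\<forall>i<n. \<forall>j<n. i \<noteq> j \<longrightarrow> {u i<..<v i} \<inter> {u j<..<v j} = {}) \<and>
        (\<Sum>k<n. v k - u k) < \<delta>
        \<longrightarrow> (\<Sum>k<n. \<bar>f (v k) - f (u k)\<bar>) < \<epsilon>)"

definition locally_absolutely_continuous :: "(real \<Rightarrow> real) \<Rightarrow> bool" where
  "locally_absolutely_continuous f \<longleftrightarrow>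
     (\<forall>a b. 0 < a \<and> a < b \<and> b < 1 \<longrightarrow> absolutely_continuous_on {a..b} f)"

abbreviation leb01 :: "real measure" where
  "leb01 \<equiv> lebesgue_on {0<..<1}"

(* Elements of L^2(0,1) are represented by functions on the real line; their values
   outside (0,1) are irrelevant, and equality is taken almost everywhere in leb01. *)
definition L2_01 :: "(real \<Rightarrow> real) set" where
  "L2_01 = {f. f \<in> borel_measurable leb01 \<and> integrable leb01 (\<lambda>x. (f x)\<^sup>2)}"

definition L2_inner :: "(real \<Rightarrow> real) \<Rightarrow> (real \<Rightarrow> real) \<Rightarrow> real" where
  "L2_inner f g = (\<integral>x. f x * g x \<partial>leb01)"

(* The derivative of a locally absolutely continuous function exists almost everywhere;
   the unspecified value of deriv on the remaining null set plays no role in the integral.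
   The value at the endpoint 1 is the trace, i.e. the limit from the left. *)
definition H1 :: "real \<Rightarrow> (real \<Rightarrow> real) set" where
  "H1 \<alpha> = {\<theta> \<in> L2_01. locally_absolutely_continuous \<theta> \<and>
              integrable leb01 (\<lambda>x. x powr \<alpha> * (deriv \<theta> x)\<^sup>2) \<and>
              (\<theta> \<longlongrightarrow> 0) (at_left 1)}"

definition flux :: "real \<Rightarrow> (real \<Rightarrow> real) \<Rightarrow> real \<Rightarrow> real" where
  "flux \<alpha> \<theta> x = x powr \<alpha> * deriv \<theta> x"

definition Pop :: "real \<Rightarrow> (real \<Rightarrow> real) \<Rightarrow> real \<Rightarrow> real" where
  "Pop \<alpha> \<theta> x = - deriv (flux \<alpha> \<theta>) x"

(* The condition BC_\<alpha>(\<theta>) = 0, with the value at x = 0 understood as a trace. *)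
definition BC_zero :: "real \<Rightarrow> (real \<Rightarrow> real) \<Rightarrow> bool" where
  "BC_zero \<alpha> \<theta> \<longleftrightarrow>
     (if \<alpha> < 1 then (\<theta> \<longlongrightarrow> 0) (at_right 0) else (flux \<alpha> \<theta> \<longlongrightarrow> 0) (at_right 0))"

(* Local absolute continuity of the flux is what makes its almost everywhere derivative
   coincide with its weak derivative: a locally integrable function has a weak derivative
   in L^2(0,1) iff it agrees almost everywhere with a locally absolutely continuous one
   whose derivative is in L^2(0,1). If the flux of a locally absolutely continuous \<theta> has
   such a representative, then \<theta> is C^1 on (0,1) and the flux is itself that
   representative. *)
definition DomP :: "real \<Rightarrow> (real \<Rightarrow> real) set" where
  "DomP \<alpha> = {\<theta> \<in> H1 \<alpha>. locally_absolutely_continuous (flux \<alpha> \<theta>) \<and> Pop \<alpha> \<theta> \<in> L2_01 \<and> BC_zero \<alpha> \<theta>}"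

(* Sequences are indexed by j \<ge> 1; their entry at index 0 is unused.
   Second clause: the linear span is dense in L^2(0,1). *)
definition Hilbert_basis_L2 :: "(nat \<Rightarrow> real \<Rightarrow> real) \<Rightarrow> bool" where
  "Hilbert_basis_L2 \<Phi> \<longleftrightarrow>
     (\<forall>j\<ge>1. \<Phi> j \<in> L2_01) \<and>
     (\<forall>i\<ge>1. \<forall>j\<ge>1. L2_inner (\<Phi> i) (\<Phi> j) = (if i = j then 1 else 0)) \<and>
     (\<forall>f\<in>L2_01. \<forall>\<epsilon>>0. \<exists>n c. (\<integral>x. (f x - (\<Sum>j=1..n. c j * \<Phi> j x))\<^sup>2 \<partial>leb01) < \<epsilon>)"

definition eigenbasis :: "real \<Rightarrow> (nat \<Rightarrow> real) \<Rightarrow> (nat \<Rightarrow> real \<Rightarrow> real) \<Rightarrow> bool" where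
  "eigenbasis \<alpha> lam \<Phi> \<longleftrightarrow>
     Hilbert_basis_L2 \<Phi> \<and>
     (\<forall>j\<ge>1. \<Phi> j \<in> DomP \<alpha> \<and> (AE x in leb01. Pop \<alpha> (\<Phi> j) x = lam j * \<Phi> j x)) \<and>
     0 < lam 1 \<and> (\<forall>j\<ge>1. lam j \<le> lam (Suc j)) \<and> filterlim lam at_top sequentially"

end

theory Submission
  imports Defs
begin

text \<open>
  A sum \<open>u = \<Sum> a\<^sub>j \<Phi>\<^sub>j\<close> over \<open>\<lambda>\<^sub>j \<le> \<Lambda>\<close> satisfies \<open>\<parallel>P\<^sup>k u\<parallel> \<le> \<Lambda>\<^sup>k \<parallel>u\<parallel>\<close> for all \<open>k\<close>. Integrating
  \<open>P\<close> twice from \<open>0\<close>, \<open>n\<close> times in a row, turns this into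
  \<open>u(x) = x\<^sup>s Q(x\<^bsup>2-\<alpha>\<^esup>) + R(x)\<close> with a polynomial \<open>Q\<close> of degree less than \<open>n\<close> and
  \<open>\<bar>R\<bar> \<le> (C\<Lambda>)\<^sup>n (n!)\<^sup>-\<^sup>2 \<parallel>u\<parallel>\<close> up to powers of \<open>\<Lambda>\<close>; here \<open>s = 1 - \<alpha>\<close> for \<open>\<alpha> < 1\<close> and
  \<open>s = 0\<close> otherwise. By Lagrange interpolation the supremum of \<open>\<bar>Q\<bar>\<close> on \<open>[0,1]\<close> is at most
  \<open>K\<^sup>n\<close> times its size at \<open>n\<close> well separated points of \<open>\<omega>\<close>. For \<open>n\<close> a large multiple of
  \<open>\<Lambda>\<^sup>1\<^sup>/\<^sup>2\<close> the factor \<open>(n!)\<^sup>-\<^sup>2\<close> absorbs \<open>K\<^sup>n R\<close>, which gives the inequality with exponent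
  \<open>1/2\<close> for every \<open>\<alpha>\<close>, and \<open>1/2 \<le> \<sigma>\<close> in all cases.
\<close>

section \<open>Almost everywhere differentiability of absolutely continuous functions\<close>

text \<open>The equation Pu = 0 has the solutions 1 and x^(1-\<alpha>) (1 and log x for \<alpha> =
  1). The condition at 0 leaves one of them, which is x^s, and each inversion of P raises exponents
  by 2-\<alpha>. The exponent 1/2 is a balance: K^n (C\<Lambda>)^n / (n!)^2 is small once n is a
  large multiple of sqrt \<Lambda>, and the price K^n is then exp(O(sqrt \<Lambda>)). Two obstacles
  shape the rest. The eigenvalue equation is given only almost everywhere and through
  \<open>deriv\<close>, so eigenfunctions must first be recognised as classical solutions; this
  rests on Lebesgue's differentiability theorem. And the hypotheses control norms, whereas
  interpolation needs point values: all P^k u must be bounded up to the degenerate endpoint, at the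
  cost of a fixed power of \<Lambda>, which the factorials absorb.\<close>

definition incr :: "(real \<Rightarrow> real) \<Rightarrow> real set \<Rightarrow> real" where
  "incr f K = f (Sup K) - f (Inf K)"

lemma incr_interval [simp]: "u \<le> v \<Longrightarrow> incr f {u..v} = f v - f u"
  by (simp add: incr_def)

lemma measure_lebesgue_interval: "u \<le> v \<Longrightarrow> measure lebesgue {u..v} = v - (u::real)"
  by simp

lemma division_of_real_interval:
  fixes D :: "real set set"
  assumes "D division_of S" "K \<in> D"
  obtains u v where "u \<le> v" "K = {u..v}"
proof -
  obtain u v where "K = {u..v}" "K \<noteq> {}"
    using division_ofD(3,4)[OF assms] by auto
  then show ?thesis
    using that by (cases "u \<le> v") auto
qed

lemma sum_incr_division:
  assumes "D division_of {a..b}" "a \<le> b"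
  shows "sum (incr f) D = f b - f a"
proof -
  \<comment> \<open>Being operative includes the value 0 on degenerate boxes, the empty one among
    them, while \<open>incr f {}\<close> evaluates \<open>Sup\<close> and \<open>Inf\<close> of the
    empty set.\<close>
  let ?g = "\<lambda>K::real set. if K = {} then 0 else incr f K"
  interpret operative_real plus 0 ?g
    rewrites "comm_monoid_set.F (+) 0 = sum"
    by standard[1] (auto simp: sum_def incr_def)
  have "sum ?g D = ?g {a..b}"
    using division assms(1) by blast
  moreover have "sum ?g D = sum (incr f) D"
    using division_ofD(3)[OF assms(1)] by (intro sum.cong) auto
  ultimately show ?thesis
    using assms(2) by simp
qed

lemma absolutely_continuous_on_division:
  assumes "absolutely_continuous_on S f" "0 < \<epsilon>"
  obtains \<delta> where "0 < \<delta>"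
    "\<And>D. D division_of \<Union>D \<Longrightarrow> \<Union>D \<subseteq> S \<Longrightarrow> measure lebesgue (\<Union>D) < \<delta> \<Longrightarrow> (\<Sum>K\<in>D. \<bar>incr f K\<bar>) < \<epsilon>"
proof -
  from assms(1)[unfolded absolutely_continuous_on_def, rule_format, OF assms(2)]
  obtain \<delta> where "0 < \<delta>" and \<delta>: "\<forall>(n::nat) u v.
        (\<forall>k<n. u k \<in> S \<and> v k \<in> S \<and> u k \<le> v k) \<and>
        (\<forall>i<n. \<forall>j<n. i \<noteq> j \<longrightarrow> {u i<..<v i} \<inter> {u j<..<v j} = {}) \<and>
        (\<Sum>k<n. v k - u k) < \<delta>
        \<longrightarrow> (\<Sum>k<n. \<bar>f (v k) - f (u k)\<bar>) < \<epsilon>"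
    by (elim exE conjE)
  show thesis
  proof (rule that[OF \<open>0 < \<delta>\<close>])
    fix D assume D: "D division_of \<Union>D" "\<Union>D \<subseteq> S" "measure lebesgue (\<Union>D) < \<delta>"
    define n where "n = card D"
    obtain h where "bij_betw h {0..<n} D"
      using ex_bij_betw_nat_finite[of D] D(1) unfolding n_def by blast
    then have h: "bij_betw h {..<n} D"
      by (simp add: atLeast0LessThan)
    have K: "\<exists>u v. u \<le> v \<and> K = {u..v}" if "K \<in> D" for K
      using division_of_real_interval[OF D(1) that] by metis
    have hD: "h k \<in> D" if "k < n" for k
      using h that by (auto simp: bij_betw_def)
    have hk: "Inf (h k) \<le> Sup (h k)" "h k = {Inf (h k)..Sup (h k)}" if k: "k < n" for k
    proof -
      obtain u v where "u \<le> v" "h k = {u..v}"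
        using K[OF hD[OF k]] by blast
      then show "Inf (h k) \<le> Sup (h k)" "h k = {Inf (h k)..Sup (h k)}"
        by simp_all
    qed
    have "(\<Sum>k<n. \<bar>f (Sup (h k)) - f (Inf (h k))\<bar>) < \<epsilon>"
    proof (rule \<delta>[rule_format, of n "\<lambda>k. Inf (h k)" "\<lambda>k. Sup (h k)"], intro conjI)
      show "\<forall>k<n. Inf (h k) \<in> S \<and> Sup (h k) \<in> S \<and> Inf (h k) \<le> Sup (h k)"
      proof (intro allI impI)
        fix k assume k: "k < n"
        then have "{Inf (h k)..Sup (h k)} \<subseteq> S"
          using D(2) hD[OF k] hk(2)[OF k] by (metis Sup_upper subset_trans)
        with hk(1)[OF k] show "Inf (h k) \<in> S \<and> Sup (h k) \<in> S \<and> Inf (h k) \<le> Sup (h k)"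
          by auto
      qed
      show "\<forall>i<n. \<forall>j<n. i \<noteq> j \<longrightarrow> {Inf (h i)<..<Sup (h i)} \<inter> {Inf (h j)<..<Sup (h j)} = {}"
      proof (intro allI impI)
        fix i j assume ij: "i < n" "j < n" "i \<noteq> j"
        then have "h i \<noteq> h j"
          using h by (auto simp: bij_betw_def inj_on_def)
        then have "interior (h i) \<inter> interior (h j) = {}"
          using division_ofD(5)[OF D(1)] hD ij by blast
        then show "{Inf (h i)<..<Sup (h i)} \<inter> {Inf (h j)<..<Sup (h j)} = {}"
          using hk(2) ij by (metis interior_atLeastAtMost_real)
      qed
      have "measure lebesgue (\<Union>D) = (\<Sum>K\<in>D. measure lebesgue K)"
        using content_division[OF D(1)] by simp
      also have "\<dots> = (\<Sum>k<n. measure lebesgue (h k))"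
        using sum.reindex_bij_betw[OF h] by metis
      also have "\<dots> = (\<Sum>k<n. Sup (h k) - Inf (h k))"
      proof (rule sum.cong[OF refl])
        fix k assume "k \<in> {..<n}"
        then have "k < n" by simp
        then show "measure lebesgue (h k) = Sup (h k) - Inf (h k)"
          using hk[of k] measure_lebesgue_interval by metis
      qed
      finally show "(\<Sum>k<n. Sup (h k) - Inf (h k)) < \<delta>"
        using D(3) by simp
    qed
    also have "(\<Sum>k<n. \<bar>f (Sup (h k)) - f (Inf (h k))\<bar>) = (\<Sum>K\<in>D. \<bar>incr f K\<bar>)"
      using sum.reindex_bij_betw[OF h, of "\<lambda>K. \<bar>incr f K\<bar>"] by (simp add: incr_def)
    finally show "(\<Sum>K\<in>D. \<bar>incr f K\<bar>) < \<epsilon>" .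
  qed
qed

text \<open>For fixed x this is the local condition of a Vitali cover. The point may sit anywhere in
  the interval, so the slope of f over it need not be a difference quotient at x; those are the
  instances where x is an endpoint.\<close>

definition fine_at :: "real \<Rightarrow> (real \<Rightarrow> real \<Rightarrow> bool) \<Rightarrow> bool" where
  "fine_at x Q \<longleftrightarrow> (\<forall>d>0. \<exists>u v. u < v \<and> x \<in> {u..v} \<and> v - u < d \<and> Q u v)"

text \<open>The disjoint countable family from Vitali's theorem lies in a set of finite measure, so
  finitely many of its members carry all but \<epsilon> of its measure. What they miss of E lies in
  a null set and the rest of the family. As E need not be measurable, the missed part is described
  by a measurable cover \<open>U\<close>.\<close>

lemma vitali_division:
  fixes E T :: "real set"
  assumes T: "open T" "bounded T" "E \<subseteq> T"
    and fine: "\<And>x. x \<in> E \<Longrightarrow> fine_at x Q"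
    and "0 < \<epsilon>"
  obtains D U where "D division_of \<Union>D" "\<Union>D \<subseteq> T"
    "\<And>K. K \<in> D \<Longrightarrow> \<exists>u v. u < v \<and> K = {u..v} \<and> Q u v"
    "E \<subseteq> \<Union>D \<union> U" "U \<in> lmeasurable" "measure lebesgue U < \<epsilon>"
proof -
  \<comment> \<open>Intervals are coded by centre and radius to match the covering theorem for
    balls; keeping them inside T bounds the measure of every finite subfamily.\<close>
  define I where "I = {(c, r::real). 0 < r \<and> cball c r \<subseteq> T \<and> Q (c - r) (c + r)}"
  have cb: "cball c r = {c - r..c + r}" for c r :: real
    by (auto simp: dist_real_def)
  have 1: "\<exists>i. i \<in> I \<and> x \<in> cball (fst i) (snd i) \<and> snd i < d" if x: "x \<in> E" and d: "0 < d" for x d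
  proof -
    obtain s where s: "0 < s" "cball x s \<subseteq> T"
      using T x by (meson open_contains_cball subsetD)
    obtain u v where uv: "u < v" "x \<in> {u..v}" "v - u < min d s" "Q u v"
      using fine[OF x] d s(1) unfolding fine_at_def by (metis min_less_iff_conj)
    have e: "(u + v)/2 - (v - u)/2 = u" "(u + v)/2 + (v - u)/2 = v"
      by (simp_all add: field_simps)
    have "((u + v)/2, (v - u)/2) \<in> I"
      unfolding I_def cb
    proof (clarsimp, intro conjI)
      show "u < v" by fact
      show "{(u + v)/2 - (v - u)/2..(u + v)/2 + (v - u)/2} \<subseteq> T"
        unfolding e using s(2) uv by (force simp: cb)
      show "Q ((u + v)/2 - (v - u)/2) ((u + v)/2 + (v - u)/2)"
        unfolding e by fact
    qed
    then show ?thesis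
      using uv by (intro exI[of _ "((u + v)/2, (v - u)/2)"] conjI) (simp_all only: cb e fst_conv snd_conv, simp_all)
  qed
  obtain C where C: "countable C" "C \<subseteq> I"
    "pairwise (\<lambda>i j. disjnt (cball (fst i) (snd i)) (cball (fst j) (snd j))) C"
    "negligible (E - (\<Union>i\<in>C. cball (fst i) (snd i)))"
  proof (rule Vitali_covering_theorem_cballs[of I snd E fst, OF _ 1])
    show "0 < snd i" if "i \<in> I" for i
      using that by (auto simp: I_def)
  qed
  define \<C> where "\<C> = (\<lambda>i. cball (fst i) (snd i)) ` C"
  have CI: "cball (fst i) (snd i) \<subseteq> T" "0 < snd i" "Q (fst i - snd i) (fst i + snd i)" if "i \<in> C" for i
    using subsetD[OF C(2) that] by (simp_all only: I_def mem_Collect_eq case_prod_beta)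
  have CT: "\<Union>\<C> \<subseteq> T"
    using CI(1) unfolding \<C>_def by blast
  have Clm: "K \<in> lmeasurable" if "K \<in> \<C>" for K
    using that by (auto simp: \<C>_def)
  have Tlm: "T \<in> lmeasurable"
    using T by (simp add: lmeasurable_open)
  have cC: "countable \<C>"
    using C(1) by (simp add: \<C>_def)
  obtain D where D: "D \<subseteq> \<C>" "finite D" "measure lebesgue (\<Union>\<C>) - \<epsilon> < measure lebesgue (\<Union>D)"
  proof (rule measure_countable_Union_approachable[OF cC \<open>0 < \<epsilon>\<close> Clm])
    fix D' assume "D' \<subseteq> \<C>" "finite D'"
    then show "measure lebesgue (\<Union>D') \<le> measure lebesgue T"
      using CT Clm Tlm by (intro measure_mono_fmeasurable fmeasurableD fmeasurable.finite_Union) auto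
  qed auto
  have Ulm: "\<Union>\<C> \<in> lmeasurable"
    using CT Tlm cC Clm
    by (meson fmeasurableI2 fmeasurableD sets.countable_Union subsetI)
  have Dlm: "\<Union>D \<in> lmeasurable"
    using D Clm by (intro fmeasurable.finite_Union) auto
  define N where "N = E - \<Union>\<C>"
  have N: "negligible N"
    using C(4) by (simp add: N_def \<C>_def)
  show thesis
  proof (rule that)
    show "D division_of \<Union>D"
    proof (rule division_ofI)
      fix K assume "K \<in> D"
      then obtain c r where K: "K = cball c r" "0 < r"
        using D(1) CI(2) unfolding \<C>_def by blast
      then show "K \<noteq> {}" by simp
      show "\<exists>a b. K = cbox a b"
        using K(1) cb by auto
    next
      fix K L assume KL: "K \<in> D" "L \<in> D" "K \<noteq> L"
      then obtain i j where ij: "i \<in> C" "j \<in> C" "K = cball (fst i) (snd i)" "L = cball (fst j) (snd j)"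
        using D(1) unfolding \<C>_def by blast
      with KL(3) have "i \<noteq> j" by auto
      with ij C(3) have "K \<inter> L = {}"
        by (auto simp: pairwise_def disjnt_def)
      then show "interior K \<inter> interior L = {}"
        using interior_subset by blast
    qed (use D in auto)
    show "\<Union>D \<subseteq> T"
      using D(1) CT by auto
    show "\<exists>u v. u < v \<and> K = {u..v} \<and> Q u v" if K: "K \<in> D" for K
    proof -
      obtain i where "K = cball (fst i) (snd i)" "i \<in> C"
        using K D(1) unfolding \<C>_def by fast
      with CI[of i] show ?thesis
        by (intro exI[of _ "fst i - snd i"] exI[of _ "fst i + snd i"]) (auto simp: cb)
    qed
    show "E \<subseteq> \<Union>D \<union> (N \<union> (\<Union>\<C> - \<Union>D))"
      by (auto simp: N_def)
    have d: "\<Union>\<C> - \<Union>D \<in> lmeasurable"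
      using Ulm Dlm by (simp add: fmeasurable_Diff fmeasurableD)
    then show "N \<union> (\<Union>\<C> - \<Union>D) \<in> lmeasurable"
      using N by (simp add: fmeasurable.Un negligible_imp_measurable)
    have "measure lebesgue (N \<union> (\<Union>\<C> - \<Union>D)) \<le> measure lebesgue N + measure lebesgue (\<Union>\<C> - \<Union>D)"
      using N d by (intro measure_Un_le) (auto dest: fmeasurableD negligible_imp_sets)
    also have "measure lebesgue N = 0"
      using N by (rule negligible_imp_measure0)
    also have "0 + measure lebesgue (\<Union>\<C> - \<Union>D) = measure lebesgue (\<Union>\<C> - \<Union>D)"
      by simp
    also have "\<dots> = measure lebesgue (\<Union>\<C>) - measure lebesgue (\<Union>D)"
      using D(1) Ulm Dlm by (intro measurable_measure_Diff) (auto dest: fmeasurableD)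
    finally show "measure lebesgue (N \<union> (\<Union>\<C> - \<Union>D)) < \<epsilon>"
      using D(3) by simp
  qed
qed

text \<open>
  Two Vitali covers of the set, one by intervals of slope below \<open>p\<close> and, inside these, one by
  intervals of slope above \<open>q\<close>, leave gaps of small total length, on which absolute continuity
  makes the increments of \<open>f\<close> negligible; so both covers carry nearly the same total increment.
\<close>

lemma negligible_oscillating_slopes:
  fixes f :: "real \<Rightarrow> real"
  assumes ac: "absolutely_continuous_on {a..b} f" and "p < q"
  defines "E \<equiv> {x \<in> {a<..<b}. fine_at x (\<lambda>u v. f v - f u < p * (v - u)) \<and>
                               fine_at x (\<lambda>u v. f v - f u > q * (v - u))}"
  shows "negligible E"
proof -
  \<comment> \<open>\<open>m\<close> is the outer measure of E, taken over open supersets because E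
    is not known to be measurable.\<close>
  define M where "M = {measure lebesgue T | T. open T \<and> E \<subseteq> T \<and> T \<subseteq> {a<..<b}}"
  define m where "m = Inf M"
  have bdd: "bdd_below M"
    by (rule bdd_belowI[of _ 0]) (auto simp: M_def)
  have ne: "M \<noteq> {}"
    unfolding M_def E_def by (simp, intro exI[of _ "{a<..<b}"]) auto
  have lm: "T \<in> lmeasurable" if "open T" "T \<subseteq> {a<..<b}" for T
    using that bounded_subset[of "{a<..<b}" T] by (intro lmeasurable_open) auto
  have m_le: "m \<le> measure lebesgue U" if U: "E \<subseteq> U" "U \<in> lmeasurable" for U
  proof (rule field_le_epsilon)
    fix e :: real assume "0 < e"
    obtain T where T: "open T" "U \<subseteq> T" "T - U \<in> lmeasurable" "emeasure lebesgue (T - U) < ennreal e"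
      using sets_lebesgue_outer_open[OF fmeasurableD[OF U(2)] \<open>0 < e\<close>] .
    have "measure lebesgue (T - U) < e"
      using T(3,4) \<open>0 < e\<close> by (simp add: emeasure_eq_measure2 ennreal_less_iff)
    have T': "open (T \<inter> {a<..<b})" "T \<inter> {a<..<b} \<subseteq> {a<..<b}" "E \<subseteq> T \<inter> {a<..<b}"
      using T U by (auto simp: E_def)
    then have "m \<le> measure lebesgue (T \<inter> {a<..<b})"
      unfolding m_def using bdd by (intro cInf_lower) (unfold M_def, blast)
    also have "\<dots> \<le> measure lebesgue (U \<union> (T - U))"
      using T(3) U(2) lm[OF T'(1,2)]
      by (intro measure_mono_fmeasurable fmeasurable.Un) (auto dest: fmeasurableD)
    also have "\<dots> \<le> measure lebesgue U + measure lebesgue (T - U)"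
      using T(3) U(2) by (intro measure_Un_le) (auto dest: fmeasurableD)
    also have "\<dots> \<le> measure lebesgue U + e"
      using \<open>measure lebesgue (T - U) < e\<close> by simp
    finally show "m \<le> measure lebesgue U + e" .
  qed
  have m_app: "\<exists>T. open T \<and> E \<subseteq> T \<and> T \<subseteq> {a<..<b} \<and> measure lebesgue T < m + e" if "0 < e" for e
  proof -
    have "Inf M < m + e" using that by (simp add: m_def)
    then show ?thesis
      using cInf_lessD[OF ne] unfolding M_def by blast
  qed
  have "m \<le> 0"
  proof (rule ccontr)
    assume "\<not> m \<le> 0"
    then have "0 < m" by simp
    \<comment> \<open>At the end 4\<eta> = (q-p)m stands against \<eta> + \<epsilon>(2(q-p) + 3|p|),
      whose second summand is made at most \<eta> by the choice of \<epsilon>. The gaps between the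
      covers have length below 3\<epsilon> < \<delta>.\<close>
    define \<eta> where "\<eta> = (q - p) * m / 4"
    have "0 < \<eta>" using \<open>0 < m\<close> \<open>p < q\<close> by (simp add: \<eta>_def)
    obtain \<delta> where "0 < \<delta>" and \<delta>: "\<And>D. D division_of \<Union>D \<Longrightarrow> \<Union>D \<subseteq> {a..b} \<Longrightarrow>
        measure lebesgue (\<Union>D) < \<delta> \<Longrightarrow> (\<Sum>K\<in>D. \<bar>incr f K\<bar>) < \<eta>"
      using absolutely_continuous_on_division[OF ac \<open>0 < \<eta>\<close>] by blast
    define \<epsilon> where "\<epsilon> = min (\<delta> / 4) (\<eta> / (2 * (q - p) + 3 * \<bar>p\<bar>))"
    have "0 < 2 * (q - p) + 3 * \<bar>p\<bar>" using \<open>p < q\<close> by simp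
    then have eps: "0 < \<epsilon>" "3 * \<epsilon> < \<delta>"
      using \<open>0 < \<delta>\<close> \<open>0 < \<eta>\<close> by (auto simp: \<epsilon>_def)
    have "\<epsilon> \<le> \<eta> / (2 * (q - p) + 3 * \<bar>p\<bar>)" by (simp add: \<epsilon>_def)
    then have eps3: "\<epsilon> * (2 * (q - p) + 3 * \<bar>p\<bar>) \<le> \<eta>"
      using \<open>0 < 2 * (q - p) + 3 * \<bar>p\<bar>\<close> by (simp only: pos_le_divide_eq)
    obtain T where T: "open T" "E \<subseteq> T" "T \<subseteq> {a<..<b}" "measure lebesgue T < m + \<epsilon>"
      using m_app[OF eps(1)] by blast
    have bT: "bounded T" using T(3) bounded_subset by (metis bounded_box box_real(1))
    obtain I U1 where I: "I division_of \<Union>I" "\<Union>I \<subseteq> T"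
      and IQ: "\<And>K. K \<in> I \<Longrightarrow> \<exists>u v. u < v \<and> K = {u..v} \<and> f v - f u < p * (v - u)"
      and U1: "E \<subseteq> \<Union>I \<union> U1" "U1 \<in> lmeasurable" "measure lebesgue U1 < \<epsilon>"
      by (rule vitali_division[OF T(1) bT T(2) _ eps(1), where Q = "\<lambda>u v. f v - f u < p * (v - u)"])
         (auto simp: E_def)
    \<comment> \<open>The second cover lives in the interiors of the first, so its intervals do not
      overlap the members outside \<open>I\<close> of a division extending \<open>I\<close>. The
      endpoints lost in this way form the null set \<open>F\<close>.\<close>
    define T2 where "T2 = (\<Union>K\<in>I. interior K)"
    have finI: "finite I" using I(1) by blast
    have T2: "open T2" "T2 \<subseteq> \<Union>I"
      using interior_subset by (auto simp: T2_def)
    have "bounded T2"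
      using T2(2) I(2) bT by (meson bounded_subset)
    then obtain J U2 where J: "J division_of \<Union>J" "\<Union>J \<subseteq> T2"
      and JQ: "\<And>K. K \<in> J \<Longrightarrow> \<exists>u v. u < v \<and> K = {u..v} \<and> f v - f u > q * (v - u)"
      and U2: "E \<inter> T2 \<subseteq> \<Union>J \<union> U2" "U2 \<in> lmeasurable" "measure lebesgue U2 < \<epsilon>"
      by (rule vitali_division[OF T2(1) _ _ _ eps(1), where Q = "\<lambda>u v. f v - f u > q * (v - u)" and E = "E \<inter> T2"])
         (auto simp: E_def)
    have finJ: "finite J" using J(1) by blast
    define F where "F = \<Union>I - T2"
    have negF: "negligible F"
    proof (rule negligible_subset)
      show "negligible (\<Union>K\<in>I. frontier K)"
        using finI negligible_convex_frontier division_of_real_interval[OF I(1)]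
        by (metis (no_types, lifting) convex_real_interval(5) finite_imageI imageE negligible_Union)
      show "F \<subseteq> (\<Union>K\<in>I. frontier K)"
        using division_ofD(4)[OF I(1)] by (force simp: F_def T2_def frontier_def)
    qed
    have lmJ: "\<Union>J \<in> lmeasurable" and lmI: "\<Union>I \<in> lmeasurable"
      using lmeasurable_division I(1) J(1) by blast+
    have mJ: "m - 2 * \<epsilon> \<le> measure lebesgue (\<Union>J)"
    proof -
      have "E \<subseteq> (\<Union>J \<union> U2) \<union> (U1 \<union> F)"
        using U1(1) U2(1) by (auto simp: F_def)
      then have "m \<le> measure lebesgue ((\<Union>J \<union> U2) \<union> (U1 \<union> F))"
        using U1(2) U2(2) lmJ negligible_imp_measurable[OF negF] by (intro m_le fmeasurable.Un)
      also have "\<dots> \<le> measure lebesgue (\<Union>J \<union> U2) + measure lebesgue (U1 \<union> F)"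
        using U1 U2 lmJ negF by (intro measure_Un_le) (auto dest: fmeasurableD negligible_imp_sets)
      also have "measure lebesgue (\<Union>J \<union> U2) \<le> measure lebesgue (\<Union>J) + measure lebesgue U2"
        using U2 lmJ by (intro measure_Un_le) (auto dest: fmeasurableD)
      also have "measure lebesgue (U1 \<union> F) \<le> measure lebesgue U1 + measure lebesgue F"
        using U1 negF by (intro measure_Un_le) (auto dest: fmeasurableD negligible_imp_sets)
      also have "measure lebesgue F = 0"
        using negF by (rule negligible_imp_measure0)
      finally show ?thesis using U1(3) U2(3) by simp
    qed
    have mIT: "measure lebesgue (\<Union>I) < m + \<epsilon>"
      using measure_mono_fmeasurable[OF I(2) fmeasurableD[OF lmI] lm[OF T(1,3)]] T(4) by simp
    have mJI: "measure lebesgue (\<Union>J) \<le> measure lebesgue (\<Union>I)"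
      using J(2) T2(2) lmI lmJ by (intro measure_mono_fmeasurable) (auto dest: fmeasurableD)
    have Iab: "\<Union>I \<subseteq> {a..b}" and Jab: "\<Union>J \<subseteq> {a..b}"
      using I(2) T(3) J(2) T2(2) by fastforce+
    have "E \<noteq> {}"
      using m_le[of "{}"] \<open>0 < m\<close> by auto
    then have "a \<le> b" by (auto simp: E_def)
    \<comment> \<open>Two divisions of [a,b] with a common part: r consists of \<open>I\<close> and
      \<open>R\<close>, s of \<open>J\<close>, \<open>R\<close> and \<open>S\<close>, so
      \<open>S\<close> has the length by which \<open>I\<close> exceeds \<open>J\<close>. Comparing
      total increments relates \<open>I\<close> to \<open>J\<close> up to the increments over
      \<open>S\<close>.\<close>
    obtain r where r: "I \<subseteq> r" "r division_of {a..b}"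
      using partial_division_extend_interval[OF I(1)] Iab by (metis box_real(2))
    define R where "R = r - I"
    have finR: "finite R" using r by (auto simp: R_def)
    have disj: "interior K \<inter> interior L = {}" if "K \<in> J" "L \<in> R" for K L
    proof -
      have "interior L \<inter> interior K' = {}" if "K' \<in> I" for K'
        using division_ofD(5)[OF r(2), of L K'] that \<open>L \<in> R\<close> r(1) by (auto simp: R_def)
      then have "interior L \<inter> T2 = {}" by (auto simp: T2_def)
      moreover have "interior K \<subseteq> T2"
        using J(2) \<open>K \<in> J\<close> interior_subset by blast
      ultimately show ?thesis by blast
    qed
    have JRdisj: "J \<inter> R = {}"
    proof -
      have "interior K \<noteq> {}" if "K \<in> J" for K
        using JQ[OF that] by auto
      then show ?thesis using disj by fastforce
    qed
    have JR: "(J \<union> R) division_of \<Union>(J \<union> R)"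
    proof (rule division_ofI)
      show "finite (J \<union> R)" using finJ finR by simp
      fix K assume K: "K \<in> J \<union> R"
      show "K \<noteq> {}" "\<exists>a b. K = cbox a b"
        using K division_ofD(3,4)[OF J(1)] division_ofD(3,4)[OF r(2)] by (auto simp: R_def)
    next
      fix K L assume KL: "K \<in> J \<union> R" "L \<in> J \<union> R" "K \<noteq> L"
      then consider "K \<in> J" "L \<in> J" | "K \<in> J" "L \<in> R" | "K \<in> R" "L \<in> J" | "K \<in> R" "L \<in> R"
        by blast
      then show "interior K \<inter> interior L = {}"
      proof cases
        case 1
        then show ?thesis using division_ofD(5)[OF J(1)] KL(3) by blast
      next
        case 4
        then show ?thesis using division_ofD(5)[OF r(2)] KL(3) unfolding R_def by blast
      qed (use disj in blast)+
    qed auto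
    have "\<Union>(J \<union> R) \<subseteq> {a..b}"
      using Jab division_ofD(2)[OF r(2)] by (auto simp: R_def)
    then obtain s where s: "J \<union> R \<subseteq> s" "s division_of {a..b}"
      using partial_division_extend_interval[OF JR] by (metis box_real(2))
    define S where "S = s - (J \<union> R)"
    have S: "S division_of \<Union>S" "\<Union>S \<subseteq> {a..b}"
    proof -
      have "s division_of \<Union>s" using s(2) by auto
      then show "S division_of \<Union>S" unfolding S_def by (rule division_of_subset) auto
      show "\<Union>S \<subseteq> {a..b}" using division_ofD(2)[OF s(2)] unfolding S_def by blast
    qed
    have fins: "finite s" using s by auto
    have dec: "sum g r = sum g I + sum g R" "sum g s = sum g J + sum g R + sum g S" for g :: "real set \<Rightarrow> real"
    proof -
      have "r = I \<union> R" "I \<inter> R = {}" using r(1) by (auto simp: R_def)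
      then show "sum g r = sum g I + sum g R"
        using finI finR sum.union_disjoint by metis
      have "s = (J \<union> R) \<union> S" "(J \<union> R) \<inter> S = {}" using s(1) by (auto simp: S_def)
      then have "sum g s = sum g (J \<union> R) + sum g S"
        using finJ finR fins sum.union_disjoint[of "J \<union> R" S g] by (auto simp: S_def)
      also have "sum g (J \<union> R) = sum g J + sum g R"
        using finJ finR JRdisj by (rule sum.union_disjoint)
      finally show "sum g s = sum g J + sum g R + sum g S" .
    qed
    have "sum (measure lebesgue) r = sum (measure lebesgue) s"
      using content_division[OF r(2)] content_division[OF s(2)] by simp
    then have "measure lebesgue (\<Union>S) = measure lebesgue (\<Union>I) - measure lebesgue (\<Union>J)"
      unfolding dec content_division[OF I(1)] content_division[OF J(1)] content_division[OF S(1)] by simp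
    then have "measure lebesgue (\<Union>S) < \<delta>"
      using mIT mJ eps(2) by simp
    then have "(\<Sum>K\<in>S. \<bar>incr f K\<bar>) < \<eta>"
      using \<delta> S by blast
    then have S\<eta>: "- \<eta> < sum (incr f) S"
      using sum_abs[of "incr f" S] by linarith
    have "sum (incr f) r = sum (incr f) s"
      using sum_incr_division r(2) s(2) \<open>a \<le> b\<close> by metis
    then have eq: "sum (incr f) I = sum (incr f) J + sum (incr f) S"
      unfolding dec by simp
    have "sum (incr f) I \<le> (\<Sum>K\<in>I. p * measure lebesgue K)"
      using IQ by (intro sum_mono) fastforce
    also have "\<dots> = p * measure lebesgue (\<Union>I)"
      unfolding sum_distrib_left[symmetric] content_division[OF I(1)] ..
    finally have leI: "sum (incr f) I \<le> p * measure lebesgue (\<Union>I)" .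
    have "(\<Sum>K\<in>J. q * measure lebesgue K) \<le> sum (incr f) J"
      using JQ by (intro sum_mono) fastforce
    moreover have "(\<Sum>K\<in>J. q * measure lebesgue K) = q * measure lebesgue (\<Union>J)"
      unfolding sum_distrib_left[symmetric] content_division[OF J(1)] ..
    ultimately have leJ: "q * measure lebesgue (\<Union>J) \<le> sum (incr f) J" by simp
    let ?mI = "measure lebesgue (\<Union>I)" and ?mJ = "measure lebesgue (\<Union>J)"
    have "(q - p) * ?mJ < \<eta> + p * (?mI - ?mJ)"
      using leI leJ eq S\<eta> by (simp add: algebra_simps)
    also have "p * (?mI - ?mJ) \<le> \<bar>p\<bar> * (3 * \<epsilon>)"
      using mJI mIT mJ by (intro mult_mono) auto
    finally have "(q - p) * ?mJ < \<eta> + 3 * \<bar>p\<bar> * \<epsilon>" by simp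
    moreover have "(q - p) * (m - 2 * \<epsilon>) \<le> (q - p) * ?mJ"
      using mJ \<open>p < q\<close> by (intro mult_left_mono) auto
    moreover have "(q - p) * m = 4 * \<eta>" by (simp add: \<eta>_def)
    ultimately show False
      using eps3 \<open>0 < \<eta>\<close> by (simp add: algebra_simps)
  qed
  show ?thesis
    unfolding negligible_outer
  proof (intro allI impI)
    fix e :: real assume "0 < e"
    then obtain T where T: "open T" "E \<subseteq> T" "T \<subseteq> {a<..<b}" "measure lebesgue T < m + e"
      using m_app by blast
    then show "\<exists>T. E \<subseteq> T \<and> T \<in> lmeasurable \<and> measure lebesgue T < e"
      using lm \<open>m \<le> 0\<close> by (intro exI[of _ T]) auto
  qed
qed

section \<open>Unbounded slopes and differentiability almost everywhere\<close>

lemma absolutely_continuous_on_subset: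
  assumes "absolutely_continuous_on S f" "T \<subseteq> S"
  shows "absolutely_continuous_on T f"
  unfolding absolutely_continuous_on_def
proof (intro allI impI)
  fix e :: real assume "0 < e"
  obtain d where d: "d > 0" "\<forall>(n::nat) u v. (\<forall>k<n. u k \<in> S \<and> v k \<in> S \<and> u k \<le> v k) \<and>
        (\<forall>i<n. \<forall>j<n. i \<noteq> j \<longrightarrow> {u i<..<v i} \<inter> {u j<..<v j} = {}) \<and>
        (\<Sum>k<n. v k - u k) < d \<longrightarrow> (\<Sum>k<n. \<bar>f (v k) - f (u k)\<bar>) < e"
    using assms(1)[unfolded absolutely_continuous_on_def, rule_format, OF \<open>0 < e\<close>] by (elim exE conjE)
  show "\<exists>d>0. \<forall>(n::nat) u v. (\<forall>k<n. u k \<in> T \<and> v k \<in> T \<and> u k \<le> v k) \<and>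
        (\<forall>i<n. \<forall>j<n. i \<noteq> j \<longrightarrow> {u i<..<v i} \<inter> {u j<..<v j} = {}) \<and>
        (\<Sum>k<n. v k - u k) < d \<longrightarrow> (\<Sum>k<n. \<bar>f (v k) - f (u k)\<bar>) < e"
  proof (intro exI[of _ d] conjI allI impI, goal_cases)
    case (2 n u v)
    then show ?case
      using assms(2) by (intro d(2)[rule_format]) auto
  qed (use d in simp)
qed

text \<open>On an open set shorter than \<delta> the increments over nonoverlapping intervals sum to
  less than 1, so intervals of slope above q have total length below 1/q there, and q is at one's
  disposal. Negligibility is local, so short neighbourhoods suffice.\<close>

lemma negligible_slopes_unbounded_above:
  fixes f :: "real \<Rightarrow> real"
  assumes ac: "absolutely_continuous_on {a..b} f"
  defines "E \<equiv> {x \<in> {a<..<b}. \<forall>q. fine_at x (\<lambda>u v. f v - f u > q * (v - u))}"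
  shows "negligible E"
proof -
  obtain \<delta> where "0 < \<delta>" and \<delta>: "\<And>D. D division_of \<Union>D \<Longrightarrow> \<Union>D \<subseteq> {a..b} \<Longrightarrow>
        measure lebesgue (\<Union>D) < \<delta> \<Longrightarrow> (\<Sum>K\<in>D. \<bar>incr f K\<bar>) < 1"
    using absolutely_continuous_on_division[OF ac zero_less_one] by blast
  have loc: "negligible (E \<inter> T)" if T: "open T" "T \<subseteq> {a<..<b}" "measure lebesgue T < \<delta>" for T
    unfolding negligible_outer
  proof (intro allI impI)
    fix e :: real assume "0 < e"
    define q where "q = 2 / e"
    have "0 < q" using \<open>0 < e\<close> by (simp add: q_def)
    have bT: "bounded T"
      using T(2) by (metis bounded_subset bounded_box box_real(1))
    obtain D U where D: "D division_of \<Union>D" "\<Union>D \<subseteq> T"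
      and DQ: "\<And>K. K \<in> D \<Longrightarrow> \<exists>u v. u < v \<and> K = {u..v} \<and> f v - f u > q * (v - u)"
      and U: "E \<inter> T \<subseteq> \<Union>D \<union> U" "U \<in> lmeasurable" "measure lebesgue U < e / 2"
      by (rule vitali_division[OF T(1) bT, of "E \<inter> T" "\<lambda>u v. f v - f u > q * (v - u)" "e / 2"])
         (use \<open>0 < e\<close> in \<open>auto simp: E_def\<close>)
    have lmD: "\<Union>D \<in> lmeasurable"
      using lmeasurable_division D(1) by blast
    have lmT: "T \<in> lmeasurable"
      using T(1) bT by (rule lmeasurable_open[rotated])
    have "measure lebesgue (\<Union>D) < \<delta>"
      using measure_mono_fmeasurable[OF D(2) fmeasurableD[OF lmD] lmT] T(3) by simp
    moreover have "\<Union>D \<subseteq> {a..b}"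
      using D(2) T(2) by fastforce
    ultimately have "(\<Sum>K\<in>D. \<bar>incr f K\<bar>) < 1"
      using \<delta> D(1) by blast
    moreover have "(\<Sum>K\<in>D. q * measure lebesgue K) \<le> (\<Sum>K\<in>D. \<bar>incr f K\<bar>)"
      using DQ by (intro sum_mono) fastforce
    ultimately have "q * measure lebesgue (\<Union>D) < 1"
      unfolding sum_distrib_left[symmetric] content_division[OF D(1)] by simp
    then have "measure lebesgue (\<Union>D) < e / 2"
      using \<open>0 < e\<close> by (simp add: q_def field_simps)
    moreover have "measure lebesgue (\<Union>D \<union> U) \<le> measure lebesgue (\<Union>D) + measure lebesgue U"
      using lmD U(2) by (intro measure_Un_le) (auto dest: fmeasurableD)
    ultimately have "measure lebesgue (\<Union>D \<union> U) < e"
      using U(3) by simp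
    then show "\<exists>T'. E \<inter> T \<subseteq> T' \<and> T' \<in> lmeasurable \<and> measure lebesgue T' < e"
      using U(1,2) lmD by (intro exI[of _ "\<Union>D \<union> U"] conjI fmeasurable.Un)
  qed
  show ?thesis
  proof (rule locally_negligible_alt[THEN iffD2], rule ballI)
    fix x assume x: "x \<in> E"
    define T where "T = {max a (x - \<delta> / 3)<..<min b (x + \<delta> / 3)}"
    have xT: "x \<in> T" using x \<open>0 < \<delta>\<close> by (auto simp: T_def E_def)
    have "measure lebesgue T < \<delta>"
      using xT \<open>0 < \<delta>\<close> unfolding T_def by (auto simp: max_def min_def)
    then have "negligible (E \<inter> T)"
      by (intro loc) (auto simp: T_def)
    then show "\<exists>U. openin (top_of_set E) U \<and> x \<in> U \<and> negligible U"
      using x xT by (intro exI[of _ "E \<inter> T"]) (auto simp: T_def intro: openin_open_Int)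
  qed
qed

lemma absolutely_continuous_on_uminus:
  assumes "absolutely_continuous_on S f"
  shows "absolutely_continuous_on S (\<lambda>x. - f x)"
proof -
  have "\<bar>- f v - - f u\<bar> = \<bar>f v - f u\<bar>" for u v by linarith
  with assms show ?thesis
    unfolding absolutely_continuous_on_def by (simp only:)
qed

lemma frequently_slope_fine_at:
  fixes f :: "real \<Rightarrow> real"
  assumes "frequently (\<lambda>y. P ((f y - f x) / (y - x))) (at x)"
  shows "fine_at x (\<lambda>u v. P ((f v - f u) / (v - u)))"
  unfolding fine_at_def
proof (intro allI impI)
  fix d :: real assume "0 < d"
  then obtain y where y: "y \<noteq> x" "dist y x < d" "P ((f y - f x) / (y - x))"
    using assms unfolding frequently_def eventually_at by (auto simp: dist_commute)
  show "\<exists>u v. u < v \<and> x \<in> {u..v} \<and> v - u < d \<and> P ((f v - f u) / (v - u))"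
  proof (cases "x < y")
    case True
    then show ?thesis using y by (intro exI[of _ x] exI[of _ y]) (auto simp: dist_real_def)
  next
    case False
    moreover have "(f x - f y) / (x - y) = (f y - f x) / (y - x)"
      by (metis minus_diff_eq minus_divide_divide)
    ultimately show ?thesis using y by (intro exI[of _ y] exI[of _ x]) (auto simp: dist_real_def)
  qed
qed

lemma fine_at_mono:
  "fine_at x P \<Longrightarrow> (\<And>u v. u < v \<Longrightarrow> P u v \<Longrightarrow> Q u v) \<Longrightarrow> fine_at x Q"
  unfolding fine_at_def by meson

text \<open>A gap between the lower and the upper limit of the difference quotients would contain
  rationals p < q, and both covering conditions would hold at x; rationality leaves countably many
  exceptional sets. The last two assumptions exclude an infinite common limit.\<close>

lemma differentiable_if_slopes_converge:
  fixes f :: "real \<Rightarrow> real"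
  assumes osc: "\<And>p q. p \<in> \<rat> \<Longrightarrow> q \<in> \<rat> \<Longrightarrow> p < q \<Longrightarrow>
      \<not> (fine_at x (\<lambda>u v. f v - f u < p * (v - u)) \<and> fine_at x (\<lambda>u v. f v - f u > q * (v - u)))"
    and up: "\<exists>q. \<not> fine_at x (\<lambda>u v. f v - f u > q * (v - u))"
    and dn: "\<exists>q. \<not> fine_at x (\<lambda>u v. f v - f u < q * (v - u))"
  shows "f differentiable (at x)"
proof -
  define s where "s y = (f y - f x) / (y - x)" for y
  let ?L = "Liminf (at x) (\<lambda>y. ereal (s y))" and ?U = "Limsup (at x) (\<lambda>y. ereal (s y))"
  have less: "fine_at x (\<lambda>u v. f v - f u < p * (v - u))" if "frequently (\<lambda>y. s y < p) (at x)" for p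
    using that unfolding s_def
    by (rule fine_at_mono[OF frequently_slope_fine_at[where P = "\<lambda>t. t < p"]]) (simp add: field_simps)
  have more: "fine_at x (\<lambda>u v. f v - f u > p * (v - u))" if "frequently (\<lambda>y. s y > p) (at x)" for p
    using that unfolding s_def
    by (rule fine_at_mono[OF frequently_slope_fine_at[where P = "\<lambda>t. t > p"]]) (simp add: field_simps)
  have "?L \<le> ?U" by (intro Liminf_le_Limsup) simp
  moreover have "\<not> ?L < ?U"
  proof
    assume "?L < ?U"
    then obtain p' where "?L < ereal p'" "ereal p' < ?U"
      using ereal_dense2 by blast
    then obtain q' where "?L < ereal p'" "ereal p' < ereal q'" "ereal q' < ?U"
      using ereal_dense2 by blast
    then have "p' < (p' + q') / 2" "(p' + q') / 2 < q'" by auto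
    then obtain p q where "p \<in> \<rat>" "p' < p" "p < (p' + q') / 2" "q \<in> \<rat>" "(p' + q') / 2 < q" "q < q'"
      using Rats_dense_in_real by metis
    then have pq: "p \<in> \<rat>" "q \<in> \<rat>" "p < q" "?L < ereal p" "ereal q < ?U"
      using \<open>?L < ereal p'\<close> \<open>ereal q' < ?U\<close>
      by (auto intro: less_trans[of ?L "ereal p'"] less_trans[of "ereal q" "ereal q'"])
    have "frequently (\<lambda>y. s y < p) (at x)"
    proof (rule ccontr)
      assume "\<not> frequently (\<lambda>y. s y < p) (at x)"
      then have "ereal p \<le> ?L"
        by (intro Liminf_bounded) (simp add: not_frequently not_less)
      with pq(4) show False by simp
    qed
    moreover have "frequently (\<lambda>y. s y > q) (at x)"
    proof (rule ccontr)
      assume "\<not> frequently (\<lambda>y. s y > q) (at x)"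
      then have "?U \<le> ereal q"
        by (intro Limsup_bounded) (simp add: not_frequently not_less)
      with pq(5) show False by simp
    qed
    ultimately show False
      using osc[OF pq(1-3)] less more by blast
  qed
  ultimately have LU: "?L = ?U" by simp
  have lim: "((\<lambda>y. ereal (s y)) \<longlongrightarrow> ?L) (at x)"
    by (rule Liminf_eq_Limsup) (simp_all add: LU)
  obtain q where q: "\<not> fine_at x (\<lambda>u v. f v - f u > q * (v - u))" using up by blast
  then have "\<not> frequently (\<lambda>y. s y > q) (at x)" using more by blast
  then have "?U \<le> ereal q"
    by (intro Limsup_bounded) (simp add: not_frequently not_less)
  then have 1: "?L \<noteq> \<infinity>" using LU by auto
  obtain q' where q': "\<not> fine_at x (\<lambda>u v. f v - f u < q' * (v - u))" using dn by blast
  then have "\<not> frequently (\<lambda>y. s y < q') (at x)" using less by blast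
  then have "ereal q' \<le> ?L"
    by (intro Liminf_bounded) (simp add: not_frequently not_less)
  then have 2: "?L \<noteq> - \<infinity>" by auto
  obtain l where "?L = ereal l" using 1 2 by (cases ?L) auto
  then have "(s \<longlongrightarrow> l) (at x)" using lim by simp
  then have "(f has_real_derivative l) (at x)"
    unfolding has_field_derivative_iff s_def .
  then show ?thesis
    using real_differentiable_def by blast
qed

theorem absolutely_continuous_on_imp_differentiable_ae:
  fixes f :: "real \<Rightarrow> real"
  assumes ac: "absolutely_continuous_on {a..b} f"
  shows "negligible {x \<in> {a<..<b}. \<not> f differentiable (at x)}"
proof -
  define E where "E p q = {x \<in> {a<..<b}. fine_at x (\<lambda>u v. f v - f u < p * (v - u)) \<and>
                               fine_at x (\<lambda>u v. f v - f u > q * (v - u))}" for p q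
  define EU where "EU g = {x \<in> {a<..<b}. \<forall>q. fine_at x (\<lambda>u v. g v - g u > q * (v - u))}"
    for g :: "real \<Rightarrow> real"
  define PQ where "PQ = {(p, q). p \<in> \<rat> \<and> q \<in> \<rat> \<and> p < (q::real)}"
  have "countable PQ"
    by (rule countable_subset[of _ "\<rat> \<times> \<rat>"]) (auto simp: PQ_def countable_rat)
  then have "negligible (\<Union>i\<in>PQ. E (fst i) (snd i))"
  proof (intro negligible_countable_Union)
    fix S assume "S \<in> (\<lambda>i. E (fst i) (snd i)) ` PQ"
    then obtain p q where "p < q" "S = E p q" by (auto simp: PQ_def)
    then show "negligible S"
      unfolding E_def using negligible_oscillating_slopes[OF ac] by blast
  qed simp
  \<comment> \<open>Slopes of f unbounded below are slopes of -f unbounded above.\<close>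
  moreover have "negligible (EU f)" "negligible (EU (\<lambda>x. - f x))"
    unfolding EU_def
    using negligible_slopes_unbounded_above ac absolutely_continuous_on_uminus[OF ac] by blast+
  ultimately have "negligible ((\<Union>i\<in>PQ. E (fst i) (snd i)) \<union> (EU f \<union> EU (\<lambda>x. - f x)))"
    by (auto intro!: negligible_Un)
  then show ?thesis
  proof (rule negligible_subset, intro subsetI, goal_cases)
    case (1 x)
    show ?case
    proof (rule ccontr)
      assume nx: "x \<notin> (\<Union>i\<in>PQ. E (fst i) (snd i)) \<union> (EU f \<union> EU (\<lambda>x. - f x))"
      note x = 1
      then have ab: "x \<in> {a<..<b}" by simp
      have "f differentiable (at x)"
      proof (rule differentiable_if_slopes_converge)
        fix p q :: real assume "p \<in> \<rat>" "q \<in> \<rat>" "p < q"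
        then have "(p, q) \<in> PQ" by (simp add: PQ_def)
        with nx have "x \<notin> E p q" by force
        with ab show "\<not> (fine_at x (\<lambda>u v. f v - f u < p * (v - u)) \<and> fine_at x (\<lambda>u v. f v - f u > q * (v - u)))"
          by (simp add: E_def)
      next
        show "\<exists>q. \<not> fine_at x (\<lambda>u v. f v - f u > q * (v - u))"
          using nx ab by (auto simp: EU_def)
        obtain q where "\<not> fine_at x (\<lambda>u v. - f v - - f u > q * (v - u))"
          using nx ab by (auto simp: EU_def)
        then have "\<not> fine_at x (\<lambda>u v. f v - f u < - q * (v - u))"
          by (rule contrapos_nn) (erule fine_at_mono, simp)
        then show "\<exists>q. \<not> fine_at x (\<lambda>u v. f v - f u < q * (v - u))" by blast
      qed
      with x show False by simp
    qed
  qed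
qed

text \<open>Almost every point has arbitrarily short intervals of slope at most c in absolute value.
  A Vitali cover by these contributes at most c(b-a) to the total increment; the intervals
  completing it to a division are shorter than \<delta> in total and contribute less than
  e/2.\<close>

lemma absolutely_continuous_on_zero_derivative:
  fixes f :: "real \<Rightarrow> real"
  assumes ac: "absolutely_continuous_on {a..b} f" and "a \<le> b"
    and N: "negligible N" and der: "\<And>x. x \<in> {a<..<b} - N \<Longrightarrow> (f has_real_derivative 0) (at x)"
  shows "f b = f a"
proof -
  have "\<bar>f b - f a\<bar> \<le> e" if e: "0 < e" for e
  proof -
    \<comment> \<open>The added 1 keeps the denominator positive when a = b.\<close>
    define c where "c = e / (2 * (b - a + 1))"
    have "0 < c" using \<open>0 < e\<close> \<open>a \<le> b\<close> by (simp add: c_def)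
    obtain \<delta> where "0 < \<delta>" and \<delta>: "\<And>D. D division_of \<Union>D \<Longrightarrow> \<Union>D \<subseteq> {a..b} \<Longrightarrow>
          measure lebesgue (\<Union>D) < \<delta> \<Longrightarrow> (\<Sum>K\<in>D. \<bar>incr f K\<bar>) < e / 2"
      using absolutely_continuous_on_division[OF ac half_gt_zero[OF e]] by blast
    have fine: "fine_at x (\<lambda>u v. \<bar>f v - f u\<bar> \<le> c * (v - u))" if x: "x \<in> {a<..<b} - N" for x
    proof -
      have "((\<lambda>y. (f y - f x) / (y - x)) \<longlongrightarrow> 0) (at x)"
        using der[OF x] by (simp add: has_field_derivative_iff)
      then have "eventually (\<lambda>y. \<bar>(f y - f x) / (y - x)\<bar> < c) (at x)"
        using \<open>0 < c\<close> by (auto simp: tendsto_iff dist_real_def)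
      then have "frequently (\<lambda>y. \<bar>(f y - f x) / (y - x)\<bar> < c) (at x)"
        by (intro eventually_frequently) auto
      from frequently_slope_fine_at[OF this] show ?thesis
        by (rule fine_at_mono) (simp add: abs_divide pos_divide_less_eq)
    qed
    obtain D U where D: "D division_of \<Union>D" "\<Union>D \<subseteq> {a<..<b}"
      and DQ: "\<And>K. K \<in> D \<Longrightarrow> \<exists>u v. u < v \<and> K = {u..v} \<and> \<bar>f v - f u\<bar> \<le> c * (v - u)"
      and U: "{a<..<b} - N \<subseteq> \<Union>D \<union> U" "U \<in> lmeasurable" "measure lebesgue U < \<delta>"
      by (rule vitali_division[OF open_greaterThanLessThan bounded_box[of a b, unfolded box_real] Diff_subset fine \<open>0 < \<delta>\<close>]) auto
    have "\<Union>D \<subseteq> {a..b}"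
      using D(2) greaterThanLessThan_subseteq_atLeastAtMost_iff[of a b a b] by (meson order_refl subset_trans)
    then obtain r where r: "D \<subseteq> r" "r division_of {a..b}"
      using partial_division_extend_interval[OF D(1)] by (metis box_real(2))
    define S where "S = r - D"
    have S: "S division_of \<Union>S" "\<Union>S \<subseteq> {a..b}"
    proof -
      have "r division_of \<Union>r" using r(2) by auto
      then show "S division_of \<Union>S" unfolding S_def by (rule division_of_subset) auto
      show "\<Union>S \<subseteq> {a..b}" using division_ofD(2)[OF r(2)] unfolding S_def by blast
    qed
    have finr: "finite r" using r by auto
    have dec: "sum g r = sum g S + sum g D" for g :: "real set \<Rightarrow> real"
      unfolding S_def by (rule sum.subset_diff[OF r(1) finr])
    have lmD: "\<Union>D \<in> lmeasurable" using lmeasurable_division D(1) by blast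
    have mD: "b - a - \<delta> < measure lebesgue (\<Union>D)"
    proof -
      have "b - a = measure lebesgue {a<..<b}" using \<open>a \<le> b\<close> by simp
      also have "\<dots> \<le> measure lebesgue ((\<Union>D \<union> U) \<union> N)"
        using U(1,2) lmD negligible_imp_measurable[OF N]
        by (intro measure_mono_fmeasurable fmeasurable.Un) auto
      also have "\<dots> \<le> measure lebesgue (\<Union>D \<union> U) + measure lebesgue N"
        using U lmD N by (intro measure_Un_le) (auto dest: fmeasurableD negligible_imp_sets)
      also have "measure lebesgue (\<Union>D \<union> U) \<le> measure lebesgue (\<Union>D) + measure lebesgue U"
        using U lmD by (intro measure_Un_le) (auto dest: fmeasurableD)
      also have "measure lebesgue N = 0" using N by (rule negligible_imp_measure0)
      finally show ?thesis using U(3) by simp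
    qed
    have tot: "measure lebesgue (\<Union>S) + measure lebesgue (\<Union>D) = b - a"
      using dec[of "measure lebesgue"] \<open>a \<le> b\<close>
      unfolding content_division[OF r(2)] content_division[OF S(1)] content_division[OF D(1)] by simp
    then have "(\<Sum>K\<in>S. \<bar>incr f K\<bar>) < e / 2"
      using \<delta> S mD by simp
    then have A: "\<bar>sum (incr f) S\<bar> < e / 2"
      using sum_abs[of "incr f" S] by linarith
    have "\<bar>sum (incr f) D\<bar> \<le> (\<Sum>K\<in>D. \<bar>incr f K\<bar>)" by (rule sum_abs)
    also have "\<dots> \<le> (\<Sum>K\<in>D. c * measure lebesgue K)"
    proof (intro sum_mono)
      fix K assume "K \<in> D"
      then obtain u v where "u < v" "K = {u..v}" "\<bar>f v - f u\<bar> \<le> c * (v - u)" using DQ by blast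
      then show "\<bar>incr f K\<bar> \<le> c * measure lebesgue K" by simp
    qed
    also have "\<dots> = c * measure lebesgue (\<Union>D)"
      unfolding sum_distrib_left[symmetric] content_division[OF D(1)] ..
    also have "\<dots> \<le> c * (b - a + 1)"
      using tot \<open>0 < c\<close> measure_nonneg[of lebesgue "\<Union>S"] by (intro mult_left_mono) linarith+
    also have "\<dots> = e / 2"
    proof -
      have "b - a + 1 \<noteq> 0" using \<open>a \<le> b\<close> by linarith
      then show ?thesis unfolding c_def by (simp add: divide_simps)
    qed
    finally have B: "\<bar>sum (incr f) D\<bar> \<le> e / 2" .
    have "f b - f a = sum (incr f) S + sum (incr f) D"
      using sum_incr_division[OF r(2) \<open>a \<le> b\<close>] dec by metis
    then show ?thesis using A B by linarith
  qed
  then have "\<bar>f b - f a\<bar> \<le> 0"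
    by (rule field_le_epsilon) simp
  then show ?thesis by simp
qed

section \<open>Recovering a continuous derivative at every point\<close>

lemma absolutely_continuous_on_diff:
  assumes "absolutely_continuous_on S f" "absolutely_continuous_on S g"
  shows "absolutely_continuous_on S (\<lambda>x. f x - g x)"
  unfolding absolutely_continuous_on_def
proof (intro allI impI)
  fix e :: real assume "0 < e"
  then have "0 < e / 2" by simp
  obtain d1 where d1: "d1 > 0" "\<forall>(n::nat) u v. (\<forall>k<n. u k \<in> S \<and> v k \<in> S \<and> u k \<le> v k) \<and>
        (\<forall>i<n. \<forall>j<n. i \<noteq> j \<longrightarrow> {u i<..<v i} \<inter> {u j<..<v j} = {}) \<and>
        (\<Sum>k<n. v k - u k) < d1 \<longrightarrow> (\<Sum>k<n. \<bar>f (v k) - f (u k)\<bar>) < e / 2"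
    using assms(1)[unfolded absolutely_continuous_on_def, rule_format, OF \<open>0 < e / 2\<close>] by (elim exE conjE)
  obtain d2 where d2: "d2 > 0" "\<forall>(n::nat) u v. (\<forall>k<n. u k \<in> S \<and> v k \<in> S \<and> u k \<le> v k) \<and>
        (\<forall>i<n. \<forall>j<n. i \<noteq> j \<longrightarrow> {u i<..<v i} \<inter> {u j<..<v j} = {}) \<and>
        (\<Sum>k<n. v k - u k) < d2 \<longrightarrow> (\<Sum>k<n. \<bar>g (v k) - g (u k)\<bar>) < e / 2"
    using assms(2)[unfolded absolutely_continuous_on_def, rule_format, OF \<open>0 < e / 2\<close>] by (elim exE conjE)
  show "\<exists>\<delta>>0. \<forall>(n::nat) u v. (\<forall>k<n. u k \<in> S \<and> v k \<in> S \<and> u k \<le> v k) \<and>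
        (\<forall>i<n. \<forall>j<n. i \<noteq> j \<longrightarrow> {u i<..<v i} \<inter> {u j<..<v j} = {}) \<and>
        (\<Sum>k<n. v k - u k) < \<delta>
        \<longrightarrow> (\<Sum>k<n. \<bar>(f (v k) - g (v k)) - (f (u k) - g (u k))\<bar>) < e"
  proof (intro exI[of _ "min d1 d2"] conjI allI impI)
    fix n :: nat and u v :: "nat \<Rightarrow> real"
    assume h: "(\<forall>k<n. u k \<in> S \<and> v k \<in> S \<and> u k \<le> v k) \<and>
        (\<forall>i<n. \<forall>j<n. i \<noteq> j \<longrightarrow> {u i<..<v i} \<inter> {u j<..<v j} = {}) \<and>
        (\<Sum>k<n. v k - u k) < min d1 d2"
    have "(\<Sum>k<n. \<bar>(f (v k) - g (v k)) - (f (u k) - g (u k))\<bar>)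
        \<le> (\<Sum>k<n. \<bar>f (v k) - f (u k)\<bar> + \<bar>g (v k) - g (u k)\<bar>)"
      by (intro sum_mono) linarith
    also have "\<dots> < e / 2 + e / 2"
      unfolding sum.distrib
      by (rule add_strict_mono; rule d1(2)[rule_format] d2(2)[rule_format]; use h in simp)
    finally show "(\<Sum>k<n. \<bar>(f (v k) - g (v k)) - (f (u k) - g (u k))\<bar>) < e" by simp
  qed (use d1 d2 in simp)
qed

lemma Lipschitz_imp_absolutely_continuous_on:
  assumes L: "\<And>u v. u \<in> S \<Longrightarrow> v \<in> S \<Longrightarrow> u \<le> v \<Longrightarrow> \<bar>f v - f u\<bar> \<le> L * (v - u)"
  shows "absolutely_continuous_on S f"
  unfolding absolutely_continuous_on_def
proof (intro allI impI)
  fix e :: real assume "0 < e"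
  show "\<exists>\<delta>>0. \<forall>(n::nat) u v. (\<forall>k<n. u k \<in> S \<and> v k \<in> S \<and> u k \<le> v k) \<and>
        (\<forall>i<n. \<forall>j<n. i \<noteq> j \<longrightarrow> {u i<..<v i} \<inter> {u j<..<v j} = {}) \<and>
        (\<Sum>k<n. v k - u k) < \<delta> \<longrightarrow> (\<Sum>k<n. \<bar>f (v k) - f (u k)\<bar>) < e"
  proof (intro exI[of _ "e / (\<bar>L\<bar> + 1)"] conjI allI impI)
    fix n :: nat and u v :: "nat \<Rightarrow> real"
    assume h: "(\<forall>k<n. u k \<in> S \<and> v k \<in> S \<and> u k \<le> v k) \<and>
        (\<forall>i<n. \<forall>j<n. i \<noteq> j \<longrightarrow> {u i<..<v i} \<inter> {u j<..<v j} = {}) \<and>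
        (\<Sum>k<n. v k - u k) < e / (\<bar>L\<bar> + 1)"
    have "(\<Sum>k<n. \<bar>f (v k) - f (u k)\<bar>) \<le> (\<Sum>k<n. (\<bar>L\<bar> + 1) * (v k - u k))"
    proof (intro sum_mono)
      fix k assume "k \<in> {..<n}"
      then have k: "u k \<in> S" "v k \<in> S" "u k \<le> v k" using h by auto
      have "\<bar>f (v k) - f (u k)\<bar> \<le> L * (v k - u k)" using k by (rule L)
      also have "\<dots> \<le> (\<bar>L\<bar> + 1) * (v k - u k)" using k(3) by (intro mult_right_mono) auto
      finally show "\<bar>f (v k) - f (u k)\<bar> \<le> (\<bar>L\<bar> + 1) * (v k - u k)" .
    qed
    also have "\<dots> = (\<bar>L\<bar> + 1) * (\<Sum>k<n. v k - u k)" by (simp add: sum_distrib_left)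
    also have "\<dots> < (\<bar>L\<bar> + 1) * (e / (\<bar>L\<bar> + 1))"
      using h by (intro mult_strict_left_mono) auto
    also have "\<dots> = e" by simp
    finally show "(\<Sum>k<n. \<bar>f (v k) - f (u k)\<bar>) < e" .
  qed (use \<open>0 < e\<close> in simp)
qed

lemma absolutely_continuous_on_imp_continuous_on:
  assumes "absolutely_continuous_on {a..b} f"
  shows "continuous_on {a..b} f"
  unfolding continuous_on_iff
proof (intro ballI allI impI)
  fix x e :: real assume x: "x \<in> {a..b}" and "0 < e"
  obtain d where d: "d > 0" "\<forall>(n::nat) u v. (\<forall>k<n. u k \<in> {a..b} \<and> v k \<in> {a..b} \<and> u k \<le> v k) \<and>
        (\<forall>i<n. \<forall>j<n. i \<noteq> j \<longrightarrow> {u i<..<v i} \<inter> {u j<..<v j} = {}) \<and>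
        (\<Sum>k<n. v k - u k) < d \<longrightarrow> (\<Sum>k<n. \<bar>f (v k) - f (u k)\<bar>) < e"
    using assms[unfolded absolutely_continuous_on_def, rule_format, OF \<open>0 < e\<close>] by (elim exE conjE)
  have *: "\<bar>f v - f u\<bar> < e" if "u \<in> {a..b}" "v \<in> {a..b}" "u \<le> v" "v - u < d" for u v
    using d(2)[rule_format, of 1 "\<lambda>_. u" "\<lambda>_. v"] that by simp
  show "\<exists>d>0. \<forall>x'\<in>{a..b}. dist x' x < d \<longrightarrow> dist (f x') (f x) < e"
  proof (intro exI[of _ d] conjI ballI impI)
    fix y assume "y \<in> {a..b}" "dist y x < d"
    then show "dist (f y) (f x) < e"
      using *[of x y] *[of y x] x by (cases "x \<le> y") (auto simp: dist_real_def abs_minus_commute)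
  qed (use d in simp)
qed

text \<open>
  \<open>deriv f x\<close> is an unspecified number where \<open>f\<close> is not differentiable, so the hypothesis is
  informative only because absolute continuity gives differentiability almost everywhere.
\<close>

lemma absolutely_continuous_on_deriv_continuous:
  fixes f :: "real \<Rightarrow> real"
  assumes ac: "absolutely_continuous_on {a..b} f" and g: "continuous_on {a..b} g"
    and N: "negligible N" and der: "\<And>x. x \<in> {a<..<b} - N \<Longrightarrow> deriv f x = g x"
    and x: "x \<in> {a<..<b}"
  shows "(f has_real_derivative g x) (at x)"
proof -
  \<comment> \<open>\<open>G\<close> is Lipschitz with derivative g, so f - G is absolutely
    continuous with derivative 0 almost everywhere, hence constant, and f inherits the derivative of
    \<open>G\<close> at every interior point.\<close>
  define G where "G x = integral {a..x} g" for x
  have G': "(G has_real_derivative g y) (at y within {a..b})" if "y \<in> {a..b}" for y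
    unfolding G_def using integral_has_real_derivative[OF g that] .
  have G: "(G has_real_derivative g y) (at y)" if y: "y \<in> {a<..<b}" for y
    using G'[of y] y at_within_Icc_at[of a y b] by auto
  have acG: "absolutely_continuous_on {a..b} G"
  proof -
    obtain B where B: "\<forall>y\<in>{a..b}. \<bar>g y\<bar> \<le> B"
      using compact_imp_bounded[OF compact_continuous_image[OF g compact_Icc]]
      by (auto simp: bounded_iff)
    show ?thesis
    proof (rule Lipschitz_imp_absolutely_continuous_on)
      fix u v assume uv: "u \<in> {a..b}" "v \<in> {a..b}" "u \<le> v"
      have "norm (G v - G u) \<le> B * norm (v - u)"
        by (rule field_differentiable_bound[OF convex_real_interval(5)[of a b], of G g])
           (use G' B uv in auto)
      then show "\<bar>G v - G u\<bar> \<le> B * (v - u)" using uv by simp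
    qed
  qed
  define F where "F y = f y - G y" for y
  have acF: "absolutely_continuous_on {a..b} F"
    unfolding F_def by (rule absolutely_continuous_on_diff[OF ac acG])
  define N' where "N' = N \<union> {x \<in> {a<..<b}. \<not> f differentiable (at x)}"
  have N': "negligible N'"
    unfolding N'_def using N absolutely_continuous_on_imp_differentiable_ae[OF ac] by (rule negligible_Un)
  have F0: "(F has_real_derivative 0) (at y)" if y: "y \<in> {a<..<b} - N'" for y
  proof -
    have "f differentiable (at y)" using y by (auto simp: N'_def)
    then have "(f has_real_derivative deriv f y) (at y)"
      using DERIV_deriv_iff_real_differentiable by blast
    moreover have "deriv f y = g y" using y by (intro der) (auto simp: N'_def)
    ultimately show ?thesis
      unfolding F_def using DERIV_diff[OF _ G, of f "g y" y] y by auto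
  qed
  have F: "F y = F a" if y: "y \<in> {a..b}" for y
  proof (rule absolutely_continuous_on_zero_derivative[of a y F, OF _ _ N'])
    show "absolutely_continuous_on {a..y} F"
      using acF y by (auto intro: absolutely_continuous_on_subset)
  qed (use y F0 in auto)
  have "((\<lambda>y. F a + G y) has_real_derivative g x) (at x)"
    using G[OF x] by (auto intro!: derivative_eq_intros)
  then show ?thesis
  proof (rule has_field_derivative_transform_within_open[where S = "{a<..<b}"])
    show "F a + G y = f y" if "y \<in> {a<..<b}" for y
      using F[of y] that unfolding F_def by auto
  qed (use x in auto)
qed

section \<open>Eigenfunctions as classical solutions\<close>

text \<open>The function and its flux solve a first-order system whose right-hand sides are
  continuous because both unknowns are absolutely continuous; hence it holds pointwise. The first
  equation has no exceptional set, being the definition of \<open>flux\<close> solved for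
  \<open>deriv\<close>.\<close>

lemma eigenfunction_classical:
  assumes eb: "eigenbasis \<alpha> lam \<Phi>" and j: "1 \<le> j" and x: "x \<in> {0<..<1}"
  shows "(\<Phi> j has_real_derivative x powr (-\<alpha>) * flux \<alpha> (\<Phi> j) x) (at x)"
    and "(flux \<alpha> (\<Phi> j) has_real_derivative - (lam j * \<Phi> j x)) (at x)"
proof -
  have dom: "\<Phi> j \<in> DomP \<alpha>" and ae: "AE x in leb01. Pop \<alpha> (\<Phi> j) x = lam j * \<Phi> j x"
    using eb j by (auto simp: eigenbasis_def)
  define a b where "a = x / 2" and "b = (x + 1) / 2"
  have ab: "0 < a" "a < b" "b < 1" "x \<in> {a<..<b}"
    using x by (auto simp: a_def b_def)
  have ac: "absolutely_continuous_on {a..b} (\<Phi> j)" "absolutely_continuous_on {a..b} (flux \<alpha> (\<Phi> j))"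
    using dom ab by (auto simp: DomP_def H1_def locally_absolutely_continuous_def)
  have cp: "continuous_on {a..b} (\<lambda>x. x powr (-\<alpha>) * flux \<alpha> (\<Phi> j) x)"
    using ab by (intro continuous_intros absolutely_continuous_on_imp_continuous_on[OF ac(2)]) auto
  show "(\<Phi> j has_real_derivative x powr (-\<alpha>) * flux \<alpha> (\<Phi> j) x) (at x)"
  proof (rule absolutely_continuous_on_deriv_continuous[OF ac(1) cp negligible_empty _ ab(4)])
    fix y assume "y \<in> {a<..<b} - {}"
    then have "0 < y" using ab by auto
    then have "y powr (-\<alpha>) * y powr \<alpha> = 1"
      by (simp flip: powr_add)
    then show "deriv (\<Phi> j) y = y powr (-\<alpha>) * flux \<alpha> (\<Phi> j) y"
      by (simp add: flux_def flip: mult.assoc)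
  qed
  have "AE x in lebesgue. x \<in> {0<..<1} \<longrightarrow> Pop \<alpha> (\<Phi> j) x = lam j * \<Phi> j x"
    using ae by (subst (asm) AE_restrict_space_iff) auto
  then obtain N where N: "negligible N" "{x. \<not> (x \<in> {0<..<1} \<longrightarrow> Pop \<alpha> (\<Phi> j) x = lam j * \<Phi> j x)} \<subseteq> N"
    by (auto simp: eventually_ae_filter negligible_iff_null_sets)
  have cu: "continuous_on {a..b} (\<lambda>x. - (lam j * \<Phi> j x))"
    by (intro continuous_intros absolutely_continuous_on_imp_continuous_on[OF ac(1)])
  show "(flux \<alpha> (\<Phi> j) has_real_derivative - (lam j * \<Phi> j x)) (at x)"
  proof (rule absolutely_continuous_on_deriv_continuous[OF ac(2) cu N(1) _ ab(4)])
    fix y assume y: "y \<in> {a<..<b} - N"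
    then have "y \<in> {0<..<1}" using ab by auto
    then have "Pop \<alpha> (\<Phi> j) y = lam j * \<Phi> j y" using N(2) y by blast
    then show "deriv (flux \<alpha> (\<Phi> j)) y = - (lam j * \<Phi> j y)"
      by (simp add: Pop_def)
  qed
qed

section \<open>Power bounds on a derivative and their consequences at the endpoints\<close>

lemma powr_antiderivative:
  fixes t C \<beta> :: real
  assumes "\<beta> \<noteq> 0" "0 < t"
  shows "((\<lambda>t. C / \<beta> * t powr \<beta>) has_real_derivative C * t powr (\<beta> - 1)) (at t)"
  using assms by (auto intro!: derivative_eq_intros simp: powr_diff)

text \<open>Adding f to, or subtracting it from, \<open>C / \<beta> * t powr \<beta>\<close> gives a
  nondecreasing function. Negative \<beta> is included for the bootstrap, whose intermediate bounds
  blow up at 0.\<close>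

lemma powr_increment_bound:
  fixes f :: "real \<Rightarrow> real"
  assumes der: "\<And>x. x \<in> {0<..<1} \<Longrightarrow> (f has_real_derivative f' x) (at x)"
    and bd: "\<And>x. x \<in> {0<..<1} \<Longrightarrow> \<bar>f' x\<bar> \<le> C * x powr (\<beta> - 1)"
    and "\<beta> \<noteq> 0" and xy: "0 < x" "x \<le> y" "y < 1"
  shows "\<bar>f y - f x\<bar> \<le> C / \<beta> * (y powr \<beta> - x powr \<beta>)"
proof -
  note d = powr_antiderivative[OF \<open>\<beta> \<noteq> 0\<close>, of _ C]
  have "C / \<beta> * x powr \<beta> - f x \<le> C / \<beta> * y powr \<beta> - f y"
  proof (rule DERIV_nonneg_imp_nondecreasing[OF xy(2)])
    fix t assume "x \<le> t" "t \<le> y"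
    then have t: "t \<in> {0<..<1}" using xy by auto
    show "\<exists>z. ((\<lambda>t. C / \<beta> * t powr \<beta> - f t) has_real_derivative z) (at t) \<and> 0 \<le> z"
      using DERIV_diff[OF d der[OF t]] bd[OF t] t by (intro exI conjI) auto
  qed
  moreover have "C / \<beta> * x powr \<beta> + f x \<le> C / \<beta> * y powr \<beta> + f y"
  proof (rule DERIV_nonneg_imp_nondecreasing[OF xy(2)])
    fix t assume "x \<le> t" "t \<le> y"
    then have t: "t \<in> {0<..<1}" using xy by auto
    show "\<exists>z. ((\<lambda>t. C / \<beta> * t powr \<beta> + f t) has_real_derivative z) (at t) \<and> 0 \<le> z"
      using DERIV_add[OF d der[OF t]] bd[OF t] t by (intro exI conjI) auto
  qed
  ultimately show ?thesis
    unfolding right_diff_distrib by linarith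
qed

lemma powr_tendsto_0_at_right_0: "0 < \<beta> \<Longrightarrow> ((\<lambda>x::real. x powr \<beta>) \<longlongrightarrow> 0) (at_right 0)"
  by (rule tendsto_zero_powrI[OF _ tendsto_const]) (auto intro: tendsto_ident_at eventually_at_right_less less_imp_le simp: eventually_at_filter)

text \<open>With K = C/\<beta>, every value f x - K x^\<beta> lies below every value f y + K
  y^\<beta>, so a single number l separates the two families. This gives the rate, and the rate
  gives the limit.\<close>

lemma powr_derivative_bound_limit_0:
  fixes f :: "real \<Rightarrow> real"
  assumes der: "\<And>x. x \<in> {0<..<1} \<Longrightarrow> (f has_real_derivative f' x) (at x)"
    and bd: "\<And>x. x \<in> {0<..<1} \<Longrightarrow> \<bar>f' x\<bar> \<le> C * x powr (\<beta> - 1)"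
    and "0 < \<beta>"
  obtains l where "(f \<longlongrightarrow> l) (at_right 0)"
    "\<And>x. x \<in> {0<..<1} \<Longrightarrow> \<bar>f x - l\<bar> \<le> C / \<beta> * x powr \<beta>"
proof -
  define K where "K = C / \<beta>"
  \<comment> \<open>The sign of C is read off from the bound at one point.\<close>
  have "0 \<le> C * (1/2) powr (\<beta> - 1)"
    using bd[of "1/2"] by (intro order_trans[OF abs_ge_zero]) auto
  then have "0 \<le> C"
    by (simp add: zero_le_mult_iff)
  then have "0 \<le> K" using \<open>0 < \<beta>\<close> by (simp add: K_def)
  have inc: "\<bar>f y - f x\<bar> \<le> K * (y powr \<beta> - x powr \<beta>)" if "0 < x" "x \<le> y" "y < 1" for x y
    unfolding K_def using powr_increment_bound[OF der bd _ that] \<open>0 < \<beta>\<close> by simp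
  have cross: "f x - K * x powr \<beta> \<le> f y + K * y powr \<beta>" if "x \<in> {0<..<1}" "y \<in> {0<..<1}" for x y
  proof -
    have "0 \<le> K * x powr \<beta>" "0 \<le> K * y powr \<beta>" using \<open>0 \<le> K\<close> by auto
    then show ?thesis
      using inc[of x y] inc[of y x] that unfolding right_diff_distrib by (cases "x \<le> y") auto
  qed
  define S where "S = (\<lambda>y. f y + K * y powr \<beta>) ` {0<..<1}"
  define l where "l = Inf S"
  have "bdd_below S"
    unfolding S_def using cross[of "1/2"] by (intro bdd_belowI2) auto
  have l: "\<bar>f x - l\<bar> \<le> K * x powr \<beta>" if x: "x \<in> {0<..<1}" for x
  proof -
    have "l \<le> f x + K * x powr \<beta>"
      unfolding l_def using \<open>bdd_below S\<close> x by (intro cInf_lower) (auto simp: S_def)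
    moreover have "f x - K * x powr \<beta> \<le> l"
      unfolding l_def using cross[OF x] by (intro cInf_greatest) (auto simp: S_def intro!: exI[of _ "1/2"])
    ultimately show ?thesis by linarith
  qed
  have "((\<lambda>x. K * x powr \<beta>) \<longlongrightarrow> 0) (at_right 0)"
    using tendsto_mult_right_zero[OF powr_tendsto_0_at_right_0[OF \<open>0 < \<beta>\<close>]] .
  then have "((\<lambda>x. f x - l) \<longlongrightarrow> 0) (at_right 0)"
  proof (rule Lim_null_comparison[rotated])
    show "\<forall>\<^sub>F x in at_right 0. norm (f x - l) \<le> K * x powr \<beta>"
      using l eventually_at_right_real[of 0 1] by (auto elim!: eventually_mono)
  qed
  then have "(f \<longlongrightarrow> l) (at_right 0)"
    by (simp add: LIM_zero_iff)
  with l show thesis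
    using that unfolding K_def by blast
qed

lemma powr_derivative_bound_limit_1:
  fixes f :: "real \<Rightarrow> real"
  assumes der: "\<And>x. x \<in> {0<..<1} \<Longrightarrow> (f has_real_derivative f' x) (at x)"
    and bd: "\<And>x. x \<in> {0<..<1} \<Longrightarrow> \<bar>f' x\<bar> \<le> C * x powr (\<beta> - 1)"
    and "\<beta> \<noteq> 0" and lim: "(f \<longlongrightarrow> 0) (at_left 1)" and x: "x \<in> {0<..<1}"
  shows "\<bar>f x\<bar> \<le> C / \<beta> * (1 - x powr \<beta>)"
proof (rule tendsto_le[OF trivial_limit_at_left_real])
  show "((\<lambda>y. C / \<beta> * (y powr \<beta> - x powr \<beta>)) \<longlongrightarrow> C / \<beta> * (1 - x powr \<beta>)) (at_left 1)"
    using \<open>\<beta> \<noteq> 0\<close> by (auto intro!: tendsto_eq_intros)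
  show "((\<lambda>y. \<bar>f y - f x\<bar>) \<longlongrightarrow> \<bar>f x\<bar>) (at_left 1)"
    using tendsto_rabs[OF tendsto_diff[OF lim tendsto_const[of "f x"]]] by simp
  have "\<forall>\<^sub>F y in at_left 1. y \<in> {x<..<1}"
    using x by (intro eventually_at_left_real) auto
  then show "\<forall>\<^sub>F y in at_left 1. \<bar>f y - f x\<bar> \<le> C / \<beta> * (y powr \<beta> - x powr \<beta>)"
    by eventually_elim (use powr_increment_bound[OF der bd \<open>\<beta> \<noteq> 0\<close>] x in auto)
qed

text \<open>Nonnegativity of the integral of (f - m)^2, where m is the mean of f over the
  interval.\<close>

lemma integral_square_le:
  fixes f :: "real \<Rightarrow> real"
  assumes "continuous_on {x..y} f" "x \<le> y"
  shows "(integral {x..y} f)\<^sup>2 \<le> (y - x) * integral {x..y} (\<lambda>t. (f t)\<^sup>2)"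
proof (cases "x = y")
  case False
  with assms(2) have "x < y" by simp
  define I where "I = integral {x..y} f"
  define m where "m = I / (y - x)"
  have f: "(f has_integral I) {x..y}"
    unfolding I_def using assms(1) integrable_continuous_interval by blast
  have f2: "((\<lambda>t. (f t)\<^sup>2) has_integral integral {x..y} (\<lambda>t. (f t)\<^sup>2)) {x..y}"
    using integrable_continuous_interval[OF continuous_on_power[OF assms(1), of 2]] by blast
  have "((\<lambda>t. (f t)\<^sup>2 - 2 * m * f t + m\<^sup>2) has_integral
      integral {x..y} (\<lambda>t. (f t)\<^sup>2) - 2 * m * I + (y - x) * m\<^sup>2) {x..y}"
    using has_integral_add[OF has_integral_diff[OF f2 has_integral_mult_right[OF f, of "2 * m"]]
        has_integral_const_real[of "m\<^sup>2" x y]] \<open>x < y\<close> by simp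
  then have "0 \<le> integral {x..y} (\<lambda>t. (f t)\<^sup>2) - 2 * m * I + (y - x) * m\<^sup>2"
  proof (rule has_integral_nonneg)
    fix t
    have "(f t)\<^sup>2 - 2 * m * f t + m\<^sup>2 = (f t - m)\<^sup>2" by (simp add: power2_diff)
    then show "0 \<le> (f t)\<^sup>2 - 2 * m * f t + m\<^sup>2" by simp
  qed
  also have "2 * m * I = 2 * (I\<^sup>2 / (y - x))" by (simp add: m_def power2_eq_square)
  also have "(y - x) * m\<^sup>2 = I\<^sup>2 / (y - x)"
    using \<open>x < y\<close> by (simp add: m_def power2_eq_square)
  finally have "I\<^sup>2 / (y - x) \<le> integral {x..y} (\<lambda>t. (f t)\<^sup>2)" by simp
  then show ?thesis
    using \<open>x < y\<close> unfolding I_def by (simp add: pos_divide_le_eq mult.commute)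
qed simp

lemma integral_subinterval_le_leb01:
  fixes f :: "real \<Rightarrow> real"
  assumes int: "integrable leb01 f" and nn: "\<And>x. 0 \<le> f x" and xy: "0 < x" "y < 1"
    and c: "continuous_on {x..y} f"
  shows "integral {x..y} f \<le> (\<integral>x. f x \<partial>leb01)"
proof -
  have "integral {x..y} f \<le> integral {0<..<1} f"
    using xy nn integrable_on_lebesgue_on[OF int] by (intro integral_subset_le integrable_continuous_interval c) auto
  also have "\<dots> = (\<integral>x. f x \<partial>leb01)"
    using lebesgue_integral_eq_integral[OF int] by simp
  finally show ?thesis .
qed

section \<open>Chains of spectral sums\<close>

text \<open>
  The model case is \<open>u k = P\<^sup>k u\<close>, with fluxes \<open>p k\<close>, for a spectral sum \<open>u\<close> of norm \<open>A\<close> with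
  eigenvalues at most \<open>L\<close>.
\<close>

definition spectral_chain :: "real \<Rightarrow> real \<Rightarrow> real \<Rightarrow> (nat \<Rightarrow> real \<Rightarrow> real) \<Rightarrow> (nat \<Rightarrow> real \<Rightarrow> real) \<Rightarrow> bool" where
  "spectral_chain \<alpha> L A u p \<longleftrightarrow>
     (\<forall>k. \<forall>x\<in>{0<..<1}. (u k has_real_derivative x powr (-\<alpha>) * p k x) (at x) \<and>
                       (p k has_real_derivative - u (Suc k) x) (at x)) \<and>
     (\<forall>k. (u k \<longlongrightarrow> 0) (at_left 1)) \<and>
     (\<forall>k. if \<alpha> < 1 then (u k \<longlongrightarrow> 0) (at_right 0) else (p k \<longlongrightarrow> 0) (at_right 0)) \<and>
     (\<forall>k. integrable leb01 (\<lambda>x. (u k x)\<^sup>2) \<and> (\<integral>x. (u k x)\<^sup>2 \<partial>leb01) \<le> (A * L ^ k)\<^sup>2)"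

lemma spectral_chainD:
  assumes "spectral_chain \<alpha> L A u p"
  shows "x \<in> {0<..<1} \<Longrightarrow> (u k has_real_derivative x powr (-\<alpha>) * p k x) (at x)"
    and "x \<in> {0<..<1} \<Longrightarrow> (p k has_real_derivative - u (Suc k) x) (at x)"
    and "(u k \<longlongrightarrow> 0) (at_left 1)"
    and "\<alpha> < 1 \<Longrightarrow> (u k \<longlongrightarrow> 0) (at_right 0)"
    and "1 \<le> \<alpha> \<Longrightarrow> (p k \<longlongrightarrow> 0) (at_right 0)"
    and "integrable leb01 (\<lambda>x. (u k x)\<^sup>2)"
    and "(\<integral>x. (u k x)\<^sup>2 \<partial>leb01) \<le> (A * L ^ k)\<^sup>2"
proof -
  note * = assms[unfolded spectral_chain_def]
  show "x \<in> {0<..<1} \<Longrightarrow> (u k has_real_derivative x powr (-\<alpha>) * p k x) (at x)"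
    "x \<in> {0<..<1} \<Longrightarrow> (p k has_real_derivative - u (Suc k) x) (at x)"
    "(u k \<longlongrightarrow> 0) (at_left 1)"
    "integrable leb01 (\<lambda>x. (u k x)\<^sup>2)"
    "(\<integral>x. (u k x)\<^sup>2 \<partial>leb01) \<le> (A * L ^ k)\<^sup>2"
    using * by blast+
  have "if \<alpha> < 1 then (u k \<longlongrightarrow> 0) (at_right 0) else (p k \<longlongrightarrow> 0) (at_right 0)"
    using * by blast
  then show "\<alpha> < 1 \<Longrightarrow> (u k \<longlongrightarrow> 0) (at_right 0)" "1 \<le> \<alpha> \<Longrightarrow> (p k \<longlongrightarrow> 0) (at_right 0)"
    by auto
qed

text \<open>A bound on \<open>u 0\<close> that is uniform over all chains thereby bounds every
  \<open>u k\<close>, with A replaced by \<open>A * L ^ k\<close>.\<close>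

lemma spectral_chain_shift:
  assumes "spectral_chain \<alpha> L A u p"
  shows "spectral_chain \<alpha> L (A * L ^ n) (\<lambda>k. u (k + n)) (\<lambda>k. p (k + n))"
proof -
  have eq: "A * L ^ n * L ^ k = A * L ^ (k + n)" for k
    by (simp add: power_add)
  show ?thesis
    using assms unfolding spectral_chain_def eq by simp
qed

text \<open>Cauchy-Schwarz for the antiderivative \<open>p 0\<close> of - \<open>u 1\<close>, whose
  norm is at most \<open>A * L\<close>. The estimate is uniform up to both endpoints, where u is not
  yet controlled.\<close>

lemma spectral_chain_flux_increment:
  assumes ch: "spectral_chain \<alpha> L A u p" and AL: "0 \<le> A" "0 \<le> L" and xy: "0 < x" "x \<le> y" "y < 1"
  shows "\<bar>p 0 y - p 0 x\<bar> \<le> sqrt (y - x) * (L * A)"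
proof -
  have sub: "{x..y} \<subseteq> {0<..<1}" using xy by auto
  have cu: "continuous_on {x..y} (u 1)"
  proof (rule DERIV_continuous_on)
    fix t assume "t \<in> {x..y}"
    then have "t \<in> {0<..<1}" using sub by blast
    from spectral_chainD(1)[OF ch this, of 1]
    show "(u 1 has_real_derivative t powr (-\<alpha>) * p 1 t) (at t within {x..y})"
      by (rule has_field_derivative_at_within)
  qed
  have "((\<lambda>t. - u 1 t) has_integral (p 0 y - p 0 x)) {x..y}"
  proof (rule fundamental_theorem_of_calculus[OF xy(2)])
    fix t assume "t \<in> {x..y}"
    then have "t \<in> {0<..<1}" using sub by blast
    from spectral_chainD(2)[OF ch this, of 0]
    have "(p 0 has_real_derivative - u 1 t) (at t)" by simp
    then show "(p 0 has_vector_derivative - u 1 t) (at t within {x..y})"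
      by (simp add: has_real_derivative_iff_has_vector_derivative has_vector_derivative_at_within)
  qed
  then have eq: "integral {x..y} (u 1) = - (p 0 y - p 0 x)"
    using has_integral_neg[of "\<lambda>t. - u 1 t"] by (intro integral_unique) (metis (no_types, lifting) ext minus_minus)
  have "(p 0 y - p 0 x)\<^sup>2 = (integral {x..y} (u 1))\<^sup>2"
    unfolding eq by (simp add: power2_commute)
  also have "\<dots> \<le> (y - x) * integral {x..y} (\<lambda>t. (u 1 t)\<^sup>2)"
    by (rule integral_square_le[OF cu xy(2)])
  also have "\<dots> \<le> (y - x) * (\<integral>x. (u 1 x)\<^sup>2 \<partial>leb01)"
    using xy by (intro mult_left_mono integral_subinterval_le_leb01 spectral_chainD(6)[OF ch] continuous_on_power cu) auto
  also have "\<dots> \<le> (y - x) * (L * A)\<^sup>2"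
    using spectral_chainD(7)[OF ch, of 1] xy by (intro mult_left_mono) (auto simp: mult.commute)
  finally have "(p 0 y - p 0 x)\<^sup>2 \<le> (sqrt (y - x) * (L * A))\<^sup>2"
    using xy by (simp add: power_mult_distrib)
  then have "\<bar>p 0 y - p 0 x\<bar> \<le> \<bar>sqrt (y - x) * (L * A)\<bar>"
    by (simp only: abs_le_square_iff)
  also have "\<dots> = sqrt (y - x) * (L * A)"
    using AL xy by (intro abs_of_nonneg mult_nonneg_nonneg) auto
  finally show ?thesis .
qed

text \<open>No zero of the flux is known, so it is compared with its value q at 1/2, from which it
  differs by at most \<open>L * A\<close>. Subtracting q x^(1-\<alpha>)/(1-\<alpha>), which has
  constant flux q, leaves a function that vanishes at 0 and is at most LA/(1-\<alpha>). The
  condition at 1 then bounds |q|/(1-\<alpha>) by the same quantity, hence the factor 2.\<close>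

lemma spectral_chain_bounded_Dirichlet:
  assumes \<alpha>: "0 < \<alpha>" "\<alpha> < 1" and ch: "spectral_chain \<alpha> L A u p" and AL: "0 \<le> A" "0 \<le> L"
    and x: "x \<in> {0<..<1}"
  shows "\<bar>u 0 x\<bar> \<le> 2 / (1 - \<alpha>) * (L * A)"
proof -
  define q where "q = p 0 (1/2)"
  define b where "b = 1 - \<alpha>"
  have b: "0 < b" "b \<le> 1" using \<alpha> by (auto simp: b_def)
  have pq: "\<bar>p 0 t - q\<bar> \<le> L * A" if t: "t \<in> {0<..<1}" for t
  proof -
    have "\<bar>p 0 t - q\<bar> \<le> sqrt \<bar>t - 1/2\<bar> * (L * A)"
      using spectral_chain_flux_increment[OF ch AL, of t "1/2"] spectral_chain_flux_increment[OF ch AL, of "1/2" t] t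
      unfolding q_def by (cases "t \<le> 1/2") (auto simp: abs_minus_commute)
    also have "\<dots> \<le> 1 * (L * A)"
      using t AL by (intro mult_right_mono) auto
    finally show ?thesis by simp
  qed
  define v where "v t = u 0 t - q / b * t powr b" for t
  have d1: "(v has_real_derivative t powr (-\<alpha>) * (p 0 t - q)) (at t)" if t: "t \<in> {0<..<1}" for t
  proof -
    have "(v has_real_derivative t powr (-\<alpha>) * p 0 t - q * t powr (b - 1)) (at t)"
      unfolding v_def using t b
      by (intro DERIV_diff spectral_chainD(1)[OF ch] powr_antiderivative) auto
    then show ?thesis by (simp add: b_def algebra_simps)
  qed
  have d2: "\<bar>t powr (-\<alpha>) * (p 0 t - q)\<bar> \<le> L * A * t powr (b - 1)" if t: "t \<in> {0<..<1}" for t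
    using mult_left_mono[OF pq[OF t], of "t powr (-\<alpha>)"] by (simp add: abs_mult b_def mult.commute)
  obtain l where l: "(v \<longlongrightarrow> l) (at_right 0)"
      "\<And>t. t \<in> {0<..<1} \<Longrightarrow> \<bar>v t - l\<bar> \<le> L * A / b * t powr b"
    using powr_derivative_bound_limit_0[OF d1 d2 b(1)] by blast
  have "(v \<longlongrightarrow> 0) (at_right 0)"
    unfolding v_def
    using tendsto_diff[OF spectral_chainD(4)[OF ch \<alpha>(2), of 0]
        tendsto_mult_right_zero[OF powr_tendsto_0_at_right_0[OF b(1)], of "q / b"]]
    by (simp only: diff_zero)
  then have "l = 0"
    using l(1) tendsto_unique trivial_limit_at_right_real by blast
  with l(2) have v: "\<bar>v t\<bar> \<le> L * A / b" if t: "t \<in> {0<..<1}" for t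
  proof -
    have "\<bar>v t\<bar> \<le> L * A / b * t powr b" using l(2)[OF t] \<open>l = 0\<close> by simp
    also have "\<dots> \<le> L * A / b * 1"
      using t b AL by (intro mult_left_mono powr_le1) auto
    finally show ?thesis by simp
  qed
  have "(v \<longlongrightarrow> 0 - q / b * 1 powr b) (at_left 1)"
    unfolding v_def by (intro tendsto_intros spectral_chainD(3)[OF ch]) auto
  then have "\<bar>0 - q / b * 1 powr b\<bar> \<le> L * A / b"
  proof (intro tendsto_upperbound[OF tendsto_rabs])
    show "\<forall>\<^sub>F t in at_left 1. \<bar>v t\<bar> \<le> L * A / b"
      using eventually_at_left_real[of 0 1] by (auto elim!: eventually_mono intro: v)
  qed auto
  then have "\<bar>q / b\<bar> \<le> L * A / b" by simp
  moreover have "\<bar>q / b * x powr b\<bar> \<le> \<bar>q / b\<bar> * 1"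
    unfolding abs_mult using x b by (intro mult_left_mono) (auto intro: powr_le1)
  ultimately have "\<bar>q / b * x powr b\<bar> \<le> L * A / b"
    by simp
  moreover have "\<bar>u 0 x\<bar> \<le> \<bar>v x\<bar> + \<bar>q / b * x powr b\<bar>"
    using abs_triangle_ineq[of "v x" "q / b * x powr b"] by (simp add: v_def)
  ultimately have "\<bar>u 0 x\<bar> \<le> L * A / b + L * A / b"
    using v[OF x] by linarith
  then show ?thesis by (simp add: b_def mult_ac)
qed

text \<open>
  Bootstrap: a bound \<open>x\<^bsup>1-\<beta>\<^esup>\<close> on the flux gives \<open>x\<^bsup>-(\<beta>-\<delta>)\<^esup>\<close> for \<open>u\<close>, hence, applied to the shifted
  chain, \<open>x\<^bsup>1-(\<beta>-\<delta>)\<^esup>\<close> for the flux. Taking \<open>\<beta>\<close> an odd multiple of \<open>\<delta>/2\<close> avoids the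
  logarithmic case \<open>\<beta> = \<delta>\<close>.
\<close>

lemma spectral_chain_bounded_Neumann_aux:
  assumes \<alpha>: "1 \<le> \<alpha>" "\<alpha> < 2"
  defines "\<delta> \<equiv> 2 - \<alpha>"
  assumes "j \<noteq> 0 \<Longrightarrow> real j * \<delta> < 1 + \<delta> / 2"
    and "\<And>L A u p (x::real). spectral_chain \<alpha> L A u p \<Longrightarrow> 0 \<le> A \<Longrightarrow> 0 \<le> L \<Longrightarrow> x \<in> {0<..<1} \<Longrightarrow>
            \<bar>p 0 x\<bar> \<le> C * (L ^ m * A) * x powr (1 - (real j * \<delta> + \<delta> / 2))"
  shows "\<exists>C m. \<forall>L A u p. \<forall>x\<in>{0<..<1}. spectral_chain \<alpha> L A u p \<longrightarrow> 0 \<le> A \<longrightarrow> 0 \<le> L \<longrightarrow> \<bar>u 0 x\<bar> \<le> C * (L ^ m * A)"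
  using assms(4,5)
proof (induction j arbitrary: C m)
  case 0
  have \<delta>: "0 < \<delta>" using \<alpha> by (simp add: \<delta>_def)
  have "\<bar>u 0 x\<bar> \<le> C * 2 / \<delta> * (L ^ m * A)"
    if ch: "spectral_chain \<alpha> L A u p" and AL: "0 \<le> A" "0 \<le> L" and x: "x \<in> {0<..<1}" for L A u p x
  proof -
    define K where "K = C * (L ^ m * A)"
    have bd: "\<bar>t powr (-\<alpha>) * p 0 t\<bar> \<le> K * t powr (\<delta> / 2 - 1)" if t: "t \<in> {0<..<1}" for t
    proof -
      have "\<bar>t powr (-\<alpha>) * p 0 t\<bar> \<le> t powr (-\<alpha>) * (K * t powr (1 - \<delta> / 2))"
        using "0.prems"(2)[OF ch AL t] by (simp add: abs_mult K_def mult_left_mono)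
      also have "\<dots> = K * t powr (-\<alpha> + (1 - \<delta> / 2))"
        unfolding powr_add by simp
      also have "-\<alpha> + (1 - \<delta> / 2) = \<delta> / 2 - 1" by (simp add: \<delta>_def field_simps)
      finally show ?thesis .
    qed
    have "0 \<le> K * (1/2) powr (\<delta> / 2 - 1)"
      using bd[of "1/2"] by (intro order_trans[OF abs_ge_zero]) auto
    then have "0 \<le> K" by (simp add: zero_le_mult_iff)
    have "\<bar>u 0 x\<bar> \<le> K / (\<delta> / 2) * (1 - x powr (\<delta> / 2))"
      using \<delta> by (intro powr_derivative_bound_limit_1[OF spectral_chainD(1)[OF ch] bd _ spectral_chainD(3)[OF ch] x]) auto
    also have "\<dots> \<le> K / (\<delta> / 2) * 1"
      using \<open>0 \<le> K\<close> \<delta> by (intro mult_left_mono) auto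
    finally show ?thesis by (simp add: K_def mult_ac)
  qed
  then show ?case by blast
next
  case (Suc j)
  have \<delta>: "0 < \<delta>" using \<alpha> by (simp add: \<delta>_def)
  define \<beta> where "\<beta> = real j * \<delta> + \<delta> / 2"
  have \<beta>: "0 < \<beta>" "\<beta> < 1" using \<delta> Suc.prems(1) by (auto simp: \<beta>_def algebra_simps intro: add_nonneg_pos)
  have u: "\<bar>u 0 x\<bar> \<le> C / \<beta> * (L ^ m * A) * x powr (- \<beta>)"
    if ch: "spectral_chain \<alpha> L A u p" and AL: "0 \<le> A" "0 \<le> L" and x: "x \<in> {0<..<1}" for L A u p x
  proof -
    define K where "K = C * (L ^ m * A)"
    have bd: "\<bar>t powr (-\<alpha>) * p 0 t\<bar> \<le> K * t powr (- \<beta> - 1)" if t: "t \<in> {0<..<1}" for t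
    proof -
      have "\<bar>p 0 t\<bar> \<le> K * t powr (1 - (\<beta> + \<delta>))"
        using Suc.prems(2)[OF ch AL t] by (simp add: K_def \<beta>_def algebra_simps)
      then have "\<bar>t powr (-\<alpha>) * p 0 t\<bar> \<le> t powr (-\<alpha>) * (K * t powr (1 - (\<beta> + \<delta>)))"
        by (simp add: abs_mult mult_left_mono)
      also have "\<dots> = K * t powr (-\<alpha> + (1 - (\<beta> + \<delta>)))"
        unfolding powr_add by simp
      also have "-\<alpha> + (1 - (\<beta> + \<delta>)) = - \<beta> - 1" by (simp add: \<delta>_def)
      finally show ?thesis .
    qed
    have "0 \<le> K * (1/2) powr (- \<beta> - 1)"
      using bd[of "1/2"] by (intro order_trans[OF abs_ge_zero]) auto
    then have "0 \<le> K" by (simp add: zero_le_mult_iff)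
    have "\<bar>u 0 x\<bar> \<le> K / (- \<beta>) * (1 - x powr (- \<beta>))"
      using \<beta> by (intro powr_derivative_bound_limit_1[OF spectral_chainD(1)[OF ch] bd _ spectral_chainD(3)[OF ch] x]) auto
    also have "\<dots> = K / \<beta> * (x powr (- \<beta>) - 1)" by (simp add: algebra_simps)
    also have "\<dots> \<le> K / \<beta> * x powr (- \<beta>)"
      using \<open>0 \<le> K\<close> \<beta> by (intro mult_left_mono) auto
    finally show ?thesis by (simp add: K_def)
  qed
  show ?case
  proof (rule Suc.IH)
    show "real j * \<delta> < 1 + \<delta> / 2" if "j \<noteq> 0"
      using Suc.prems(1) \<delta> by (simp add: algebra_simps)
    fix L A x :: real and u p
    assume ch: "spectral_chain \<alpha> L A u p" and AL: "0 \<le> A" "0 \<le> L" and x: "x \<in> {0<..<1}"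
    \<comment> \<open>One more power of L per round: the bound on u is applied to the chain starting
      at \<open>u 1\<close>, whose size is \<open>A * L\<close>.\<close>
    define K where "K = C / \<beta> * (L ^ Suc m * A)"
    have bd: "\<bar>- u 1 t\<bar> \<le> K * t powr ((1 - \<beta>) - 1)" if t: "t \<in> {0<..<1}" for t
      using u[OF spectral_chain_shift[OF ch, of 1] _ AL(2) t] AL by (simp add: K_def mult_ac)
    have der: "(p 0 has_real_derivative - u 1 t) (at t)" if t: "t \<in> {0<..<1}" for t
      using spectral_chainD(2)[OF ch t, of 0] by simp
    have \<beta>1: "0 < 1 - \<beta>" using \<beta> by simp
    obtain l where l: "(p 0 \<longlongrightarrow> l) (at_right 0)"
      "\<And>t. t \<in> {0<..<1} \<Longrightarrow> \<bar>p 0 t - l\<bar> \<le> K / (1 - \<beta>) * t powr (1 - \<beta>)"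
      using powr_derivative_bound_limit_0[OF der bd \<beta>1] by blast
    have "l = 0"
      using l(1) spectral_chainD(5)[OF ch \<alpha>(1), of 0] tendsto_unique trivial_limit_at_right_real by blast
    with l(2)[OF x] show "\<bar>p 0 x\<bar> \<le> C / \<beta> / (1 - \<beta>) * (L ^ Suc m * A) * x powr (1 - (real j * \<delta> + \<delta> / 2))"
      by (simp add: K_def \<beta>_def)
  qed
qed

text \<open>C and m depend on \<alpha> alone, so the bound may be applied to shifted chains. For
  \<alpha> \<ge> 1 the flux vanishes at 0, and its Hoelder bound \<open>sqrt x * (L * A)\<close>
  starts the bootstrap.\<close>

lemma spectral_chain_bounded:
  assumes \<alpha>: "0 < \<alpha>" "\<alpha> < 2"
  shows "\<exists>C m. \<forall>L A u p. \<forall>x\<in>{0<..<1}. spectral_chain \<alpha> L A u p \<longrightarrow> 0 \<le> A \<longrightarrow> 0 \<le> L \<longrightarrow> \<bar>u 0 x\<bar> \<le> C * (L ^ m * A)"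
proof (cases "\<alpha> < 1")
  case True
  show ?thesis
  proof (intro exI[of _ "2 / (1 - \<alpha>)"] exI[of _ 1] allI ballI impI)
    fix L A x :: real and u p
    assume "x \<in> {0<..<1}" "spectral_chain \<alpha> L A u p" "0 \<le> A" "0 \<le> L"
    then show "\<bar>u 0 x\<bar> \<le> 2 / (1 - \<alpha>) * (L ^ 1 * A)"
      using spectral_chain_bounded_Dirichlet[OF \<alpha>(1) True, of L A u p x] by simp
  qed
next
  case False
  define \<delta> where "\<delta> = 2 - \<alpha>"
  have \<delta>: "0 < \<delta>" using \<alpha> by (simp add: \<delta>_def)
  define P where "P j \<longleftrightarrow> 1/2 \<le> real j * \<delta> + \<delta> / 2" for j
  have "\<exists>j. P j"
  proof -
    obtain j :: nat where "1 / \<delta> < real j" using reals_Archimedean2 by blast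
    then have "1 < real j * \<delta>" using \<delta> by (simp add: field_simps)
    then have "P j" using \<delta> by (simp add: P_def)
    then show ?thesis ..
  qed
  \<comment> \<open>\<open>P j\<close> makes x^(1/2) at most x^(1-(j\<delta>+\<delta>/2)) on (0,1).
    Minimality gives j\<delta> < 1/2 + \<delta>/2 unless j = 0, so the exponents \<beta> met in the
    descent stay below 1 and x^(-\<beta>) stays integrable at 0.\<close>
  define j where "j = (LEAST j. P j)"
  have Pj: "P j" unfolding j_def using \<open>\<exists>j. P j\<close> by (rule LeastI_ex)
  show ?thesis
  proof (rule spectral_chain_bounded_Neumann_aux[of \<alpha> j 1 1])
    show "1 \<le> \<alpha>" "\<alpha> < 2" using False \<alpha> by auto
    show "real j * (2 - \<alpha>) < 1 + (2 - \<alpha>) / 2" if "j \<noteq> 0"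
    proof -
      have "\<not> P (j - 1)" using that unfolding j_def by (intro not_less_Least) auto
      then show ?thesis
        using that unfolding P_def \<delta>_def[symmetric] by (simp add: of_nat_diff algebra_simps)
    qed
    fix L A x :: real and u p
    assume ch: "spectral_chain \<alpha> L A u p" and AL: "0 \<le> A" "0 \<le> L" and x: "x \<in> {0<..<1}"
    have "\<bar>p 0 x\<bar> \<le> sqrt x * (L * A)"
    proof (rule tendsto_le[OF trivial_limit_at_right_real])
      show "((\<lambda>y. sqrt (x - y) * (L * A)) \<longlongrightarrow> sqrt x * (L * A)) (at_right 0)"
        by (auto intro!: tendsto_eq_intros)
      show "((\<lambda>y. \<bar>p 0 x - p 0 y\<bar>) \<longlongrightarrow> \<bar>p 0 x\<bar>) (at_right 0)"
        using tendsto_rabs[OF tendsto_diff[OF tendsto_const[of "p 0 x"] spectral_chainD(5)[OF ch, of 0]]] False by simp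
      have "\<forall>\<^sub>F y in at_right 0. y \<in> {0<..<x}"
        using x by (intro eventually_at_right_real) auto
      then show "\<forall>\<^sub>F y in at_right 0. \<bar>p 0 x - p 0 y\<bar> \<le> sqrt (x - y) * (L * A)"
        by eventually_elim (use spectral_chain_flux_increment[OF ch AL] x in auto)
    qed
    also have "sqrt x = x powr (1/2)" using x by (simp add: powr_half_sqrt)
    also have "x powr (1/2) * (L * A) \<le> x powr (1 - (real j * \<delta> + \<delta> / 2)) * (L * A)"
      using x Pj AL unfolding P_def by (intro mult_right_mono powr_mono') auto
    finally show "\<bar>p 0 x\<bar> \<le> 1 * (L ^ 1 * A) * x powr (1 - (real j * (2 - \<alpha>) + (2 - \<alpha>) / 2))"
      by (simp add: \<delta>_def mult_ac)
  qed
qed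

text \<open>Induction on n for all k at once: the expansion of \<open>u (Suc k)\<close> to order n,
  integrated to the flux, multiplied by x^(-\<alpha>) and integrated again, is one of
  \<open>u k\<close> to order n + 1. Of the two integration constants the condition at 0 removes
  one: for \<alpha> < 1 that of u, leaving x^(1-\<alpha>), otherwise that of the flux, leaving 1.
  This explains s.\<close>

lemma spectral_chain_expansion_aux:
  assumes \<alpha>: "0 < \<alpha>" "\<alpha> < 2" and ch: "spectral_chain \<alpha> L A u p" and L: "0 \<le> L"
    and M: "\<And>k x. x \<in> {0<..<1} \<Longrightarrow> \<bar>u k x\<bar> \<le> M * L ^ k" "0 \<le> M"
  defines "\<delta> \<equiv> 2 - \<alpha>" and "s \<equiv> (if \<alpha> < 1 then 1 - \<alpha> else 0)"
  shows "\<exists>c. \<forall>x\<in>{0<..<1}. \<bar>u k x - (\<Sum>i<n. c i * x powr (s + real i * \<delta>))\<bar>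
            \<le> M * L ^ (k + n) * ((2 / \<delta>\<^sup>2) ^ n / (fact n)\<^sup>2) * x powr (real n * \<delta>)"
proof (induction n arbitrary: k)
  case 0
  then show ?case using M(1) by simp
next
  case (Suc n)
  have \<delta>: "0 < \<delta>" "\<delta> < 2" using \<alpha> by (auto simp: \<delta>_def)
  have s: "0 \<le> s" by (auto simp: s_def)
  define B where "B = M * L ^ (Suc k + n) * ((2 / \<delta>\<^sup>2) ^ n / (fact n)\<^sup>2)"
  have "0 \<le> B" using M(2) L by (simp add: B_def)
  obtain c where c: "\<And>x. x \<in> {0<..<1} \<Longrightarrow>
      \<bar>u (Suc k) x - (\<Sum>i<n. c i * x powr (s + real i * \<delta>))\<bar> \<le> B * x powr (real n * \<delta>)"
    using Suc.IH[of "Suc k"] unfolding B_def by blast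
  define e where "e i = s + real i * \<delta>" for i
  have e: "0 \<le> e i" for i using s \<delta> by (simp add: e_def)
  have e1: "0 < e i + 1" "0 < e i + \<delta>" for i using e[of i] \<delta> by auto
  define S where "S x = (\<Sum>i<n. c i / (e i + 1) * x powr (e i + 1))" for x
  \<comment> \<open>Here and in \<open>v\<close> below an antiderivative of the known terms is
    removed, with a plus sign because the flux has derivative - \<open>u (Suc k)\<close>. The
    derivative left over is controlled by the previous remainder.\<close>
  define w where "w x = p k x + S x" for x
  have w': "(w has_real_derivative - u (Suc k) x + (\<Sum>i<n. c i * x powr e i)) (at x)" if x: "x \<in> {0<..<1}" for x
  proof -
    have "(S has_real_derivative (\<Sum>i<n. c i * x powr (e i + 1 - 1))) (at x)"
      unfolding S_def
    proof (rule DERIV_sum)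
      fix i
      show "((\<lambda>x. c i / (e i + 1) * x powr (e i + 1)) has_real_derivative c i * x powr (e i + 1 - 1)) (at x)"
        using e1(1)[of i] x by (intro powr_antiderivative) auto
    qed
    then show ?thesis
      unfolding w_def using DERIV_add[OF spectral_chainD(2)[OF ch x]] by simp
  qed
  have wb: "\<bar>- u (Suc k) x + (\<Sum>i<n. c i * x powr e i)\<bar> \<le> B * x powr ((real n * \<delta> + 1) - 1)" if x: "x \<in> {0<..<1}" for x
    using c[OF x] by (simp add: e_def abs_minus_commute)
  have n1: "0 < real n * \<delta> + 1" using \<delta> by (simp add: add_nonneg_pos)
  obtain l where l: "(w \<longlongrightarrow> l) (at_right 0)"
    "\<And>x. x \<in> {0<..<1} \<Longrightarrow> \<bar>w x - l\<bar> \<le> B / (real n * \<delta> + 1) * x powr (real n * \<delta> + 1)"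
    using powr_derivative_bound_limit_0[OF w' wb n1] by blast
  have "(S \<longlongrightarrow> (\<Sum>i<n. c i / (e i + 1) * 0)) (at_right 0)"
    unfolding S_def using e1 by (intro tendsto_sum tendsto_mult tendsto_const powr_tendsto_0_at_right_0)
  then have S0: "(S \<longlongrightarrow> 0) (at_right 0)" by simp
  have l0: "l = 0" if "1 \<le> \<alpha>"
  proof -
    have "(w \<longlongrightarrow> 0 + 0) (at_right 0)"
      unfolding w_def by (rule tendsto_add[OF spectral_chainD(5)[OF ch that] S0])
    then show ?thesis using l(1) tendsto_unique trivial_limit_at_right_real by fastforce
  qed
  \<comment> \<open>Chosen so that q x^(1-\<alpha>) has constant flux l; for \<alpha> \<ge> 1 that
    constant is 0.\<close>
  define q where "q = (if \<alpha> < 1 then l / (1 - \<alpha>) else 0)"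
  define R where "R x = (\<Sum>i<n. c i / (e i + 1) / (e i + \<delta>) * x powr (e i + \<delta>))" for x
  define v where "v x = u k x - q * x powr (1 - \<alpha>) + R x" for x
  have v': "(v has_real_derivative x powr (-\<alpha>) * (w x - l)) (at x)" if x: "x \<in> {0<..<1}" for x
  proof -
    have "(R has_real_derivative (\<Sum>i<n. c i / (e i + 1) * x powr (e i + \<delta> - 1))) (at x)"
      unfolding R_def
    proof (rule DERIV_sum)
      fix i
      show "((\<lambda>x. c i / (e i + 1) / (e i + \<delta>) * x powr (e i + \<delta>)) has_real_derivative
             c i / (e i + 1) * x powr (e i + \<delta> - 1)) (at x)"
        using e1(2)[of i] x by (intro powr_antiderivative) auto
    qed
    moreover have "(\<Sum>i<n. c i / (e i + 1) * x powr (e i + \<delta> - 1)) = x powr (-\<alpha>) * S x"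
      unfolding S_def sum_distrib_left
    proof (rule sum.cong[OF refl])
      fix i
      have "e i + \<delta> - 1 = -\<alpha> + (e i + 1)" by (simp add: \<delta>_def)
      then show "c i / (e i + 1) * x powr (e i + \<delta> - 1) = x powr (-\<alpha>) * (c i / (e i + 1) * x powr (e i + 1))"
        by (simp only: powr_add mult_ac)
    qed
    ultimately have R': "(R has_real_derivative x powr (-\<alpha>) * S x) (at x)" by simp
    have Q': "((\<lambda>x. q * x powr (1 - \<alpha>)) has_real_derivative l * x powr (-\<alpha>)) (at x)"
    proof (cases "\<alpha> < 1")
      case True
      then show ?thesis
        using powr_antiderivative[of "1 - \<alpha>" x l] x by (simp add: q_def)
    next
      case False
      then show ?thesis using l0 by (simp add: q_def)
    qed
    have "(v has_real_derivative x powr (-\<alpha>) * p k x - l * x powr (-\<alpha>) + x powr (-\<alpha>) * S x) (at x)"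
      unfolding v_def by (intro DERIV_add DERIV_diff spectral_chainD(1)[OF ch x] Q' R')
    then show ?thesis by (simp add: w_def algebra_simps)
  qed
  define B' where "B' = B / (real n * \<delta> + 1)"
  have "0 \<le> B'" using \<open>0 \<le> B\<close> n1 by (simp add: B'_def)
  have vb: "\<bar>x powr (-\<alpha>) * (w x - l)\<bar> \<le> B' * x powr (real (Suc n) * \<delta> - 1)" if x: "x \<in> {0<..<1}" for x
  proof -
    have "\<bar>x powr (-\<alpha>) * (w x - l)\<bar> \<le> x powr (-\<alpha>) * (B' * x powr (real n * \<delta> + 1))"
    proof -
      have "\<bar>w x - l\<bar> \<le> B' * x powr (real n * \<delta> + 1)" using l(2)[OF x] by (simp add: B'_def)
      then show ?thesis by (simp add: abs_mult mult_left_mono)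
    qed
    also have "\<dots> = B' * x powr (-\<alpha> + (real n * \<delta> + 1))"
      unfolding powr_add by simp
    also have "-\<alpha> + (real n * \<delta> + 1) = real (Suc n) * \<delta> - 1"
      by (simp add: \<delta>_def algebra_simps)
    finally show ?thesis .
  qed
  have n2: "0 < real (Suc n) * \<delta>" using \<delta> by simp
  obtain r where r: "(v \<longlongrightarrow> r) (at_right 0)"
    "\<And>x. x \<in> {0<..<1} \<Longrightarrow> \<bar>v x - r\<bar> \<le> B' / (real (Suc n) * \<delta>) * x powr (real (Suc n) * \<delta>)"
    using powr_derivative_bound_limit_0[OF v' vb n2] by blast
  have r0: "r = 0" if "\<alpha> < 1"
  proof -
    have "(R \<longlongrightarrow> (\<Sum>i<n. c i / (e i + 1) / (e i + \<delta>) * 0)) (at_right 0)"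
      unfolding R_def using e1 by (intro tendsto_sum tendsto_mult tendsto_const powr_tendsto_0_at_right_0)
    moreover have "((\<lambda>x. q * x powr (1 - \<alpha>)) \<longlongrightarrow> q * 0) (at_right 0)"
      using that by (intro tendsto_mult tendsto_const powr_tendsto_0_at_right_0) auto
    ultimately have "(v \<longlongrightarrow> 0 - q * 0 + (\<Sum>i<n. c i / (e i + 1) / (e i + \<delta>) * 0)) (at_right 0)"
      unfolding v_def by (intro tendsto_add tendsto_diff spectral_chainD(4)[OF ch that])
    then have "(v \<longlongrightarrow> 0) (at_right 0)" by simp
    then show ?thesis using r(1) tendsto_unique trivial_limit_at_right_real by blast
  qed
  \<comment> \<open>The surviving integration constant becomes the leading coefficient, and the old
    coefficients move up one place, with the minus sign in the definition of P.\<close>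
  define c' where "c' i = (case i of 0 \<Rightarrow> if \<alpha> < 1 then q else r | Suc i \<Rightarrow> - (c i / (e i + 1) / (e i + \<delta>)))" for i
  have eq: "u k x - (\<Sum>i<Suc n. c' i * x powr (s + real i * \<delta>)) = v x - r" if x: "x \<in> {0<..<1}" for x
  proof -
    have "(\<Sum>i<Suc n. c' i * x powr (s + real i * \<delta>)) = c' 0 * x powr s - R x"
    proof -
      have "(\<Sum>i<n. c' (Suc i) * x powr (s + real (Suc i) * \<delta>)) = (\<Sum>i<n. - (c i / (e i + 1) / (e i + \<delta>) * x powr (e i + \<delta>)))"
        by (intro sum.cong) (simp_all add: c'_def e_def algebra_simps)
      then show ?thesis
        by (simp add: sum.lessThan_Suc_shift R_def sum_negf del: sum.lessThan_Suc of_nat_Suc)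
    qed
    moreover have "c' 0 * x powr s = q * x powr (1 - \<alpha>) + r"
      using r0 x by (auto simp: c'_def s_def q_def)
    ultimately show ?thesis by (simp add: v_def)
  qed
  have fin: "B' / (real (Suc n) * \<delta>) \<le> M * L ^ (k + Suc n) * ((2 / \<delta>\<^sup>2) ^ Suc n / (fact (Suc n))\<^sup>2)"
  proof -
    \<comment> \<open>The two integrations divide by n\<delta> + 1 and (n+1)\<delta>. As \<delta> <
      2, the product is at least \<delta>^2 (n+1)^2 / 2, which produces (n!)^2 and the constant
      2/\<delta>^2.\<close>
    have "real (Suc n) * \<delta> / 2 \<le> real n * \<delta> + 1"
    proof -
      have "0 \<le> real n * \<delta>" using \<delta> by simp
      moreover have "real (Suc n) * \<delta> = real n * \<delta> + \<delta>" by (simp add: algebra_simps)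
      ultimately show ?thesis using \<delta> by linarith
    qed
    then have "(real (Suc n) * \<delta> / 2) * (real (Suc n) * \<delta>) \<le> (real n * \<delta> + 1) * (real (Suc n) * \<delta>)"
      using \<delta> by (intro mult_right_mono) auto
    then have "B / ((real n * \<delta> + 1) * (real (Suc n) * \<delta>)) \<le> B / ((real (Suc n) * \<delta> / 2) * (real (Suc n) * \<delta>))"
      using \<open>0 \<le> B\<close> \<delta> n1 n2 by (intro divide_left_mono mult_pos_pos) auto
    also have "\<dots> = B * ((2 / \<delta>\<^sup>2) / (real (Suc n))\<^sup>2)"
      using \<delta> by (simp add: power2_eq_square)
    also have "\<dots> = M * L ^ (k + Suc n) * ((2 / \<delta>\<^sup>2) ^ Suc n / (fact (Suc n))\<^sup>2)"
      unfolding B_def by (simp add: power_mult_distrib mult_ac del: of_nat_Suc)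
    finally show ?thesis by (simp add: B'_def)
  qed
  show ?case
  proof (intro exI[of _ c'] ballI)
    fix x :: real assume x: "x \<in> {0<..<1}"
    have "\<bar>v x - r\<bar> \<le> B' / (real (Suc n) * \<delta>) * x powr (real (Suc n) * \<delta>)" by (rule r(2)[OF x])
    also have "\<dots> \<le> M * L ^ (k + Suc n) * ((2 / \<delta>\<^sup>2) ^ Suc n / (fact (Suc n))\<^sup>2) * x powr (real (Suc n) * \<delta>)"
      using fin by (rule mult_right_mono) simp
    finally show "\<bar>u k x - (\<Sum>i<Suc n. c' i * x powr (s + real i * \<delta>))\<bar>
        \<le> M * L ^ (k + Suc n) * ((2 / \<delta>\<^sup>2) ^ Suc n / (fact (Suc n))\<^sup>2) * x powr (real (Suc n) * \<delta>)"
      unfolding eq[OF x] .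
  qed
qed

lemma spectral_chain_expansion:
  assumes \<alpha>: "0 < \<alpha>" "\<alpha> < 2" and ch: "spectral_chain \<alpha> L A u p" and L: "0 \<le> L"
    and M: "\<And>k x. x \<in> {0<..<1} \<Longrightarrow> \<bar>u k x\<bar> \<le> M * L ^ k" "0 \<le> M" and "0 < n"
  obtains P where "degree P < n"
    "\<And>x. x \<in> {0<..<1} \<Longrightarrow> \<bar>u 0 x - x powr (if \<alpha> < 1 then 1 - \<alpha> else 0) * poly P (x powr (2 - \<alpha>))\<bar>
            \<le> M * L ^ n * ((2 / (2 - \<alpha>)\<^sup>2) ^ n / (fact n)\<^sup>2)"
proof -
  define \<delta> where "\<delta> = 2 - \<alpha>"
  have \<delta>: "0 < \<delta>" using \<alpha> by (simp add: \<delta>_def)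
  define s where "s = (if \<alpha> < 1 then 1 - \<alpha> else 0)"
  have "\<exists>c. \<forall>x\<in>{0<..<1}. \<bar>u 0 x - (\<Sum>i<n. c i * x powr (s + real i * \<delta>))\<bar>
            \<le> M * L ^ n * ((2 / \<delta>\<^sup>2) ^ n / (fact n)\<^sup>2) * x powr (real n * \<delta>)"
    using spectral_chain_expansion_aux[OF \<alpha> ch L M, of 0 n] unfolding s_def \<delta>_def by (simp only: add_0)
  then obtain c where c: "\<And>x. x \<in> {0<..<1} \<Longrightarrow> \<bar>u 0 x - (\<Sum>i<n. c i * x powr (s + real i * \<delta>))\<bar>
            \<le> M * L ^ n * ((2 / \<delta>\<^sup>2) ^ n / (fact n)\<^sup>2) * x powr (real n * \<delta>)"
    by blast
  define P where "P = (\<Sum>i<n. monom (c i) i)"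
  show thesis
  proof (rule that)
    have "degree P \<le> n - 1"
      unfolding P_def using \<open>0 < n\<close> by (intro degree_sum_le) (auto intro: order_trans[OF degree_monom_le])
    then show "degree P < n" using \<open>0 < n\<close> by simp
    fix x :: real assume x: "x \<in> {0<..<1}"
    have "x powr s * poly P (x powr \<delta>) = (\<Sum>i<n. c i * x powr (s + real i * \<delta>))"
      unfolding P_def poly_sum sum_distrib_left
    proof (intro sum.cong refl)
      fix i
      have "(x powr \<delta>) ^ i = x powr (real i * \<delta>)"
        using x by (simp add: powr_realpow[symmetric] powr_powr mult.commute)
      then show "x powr s * poly (monom (c i) i) (x powr \<delta>) = c i * x powr (s + real i * \<delta>)"
        by (simp add: poly_monom powr_add)
    qed
    then have "\<bar>u 0 x - x powr s * poly P (x powr \<delta>)\<bar>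
        \<le> M * L ^ n * ((2 / \<delta>\<^sup>2) ^ n / (fact n)\<^sup>2) * x powr (real n * \<delta>)"
      using c[OF x] by simp
    also have "\<dots> \<le> M * L ^ n * ((2 / \<delta>\<^sup>2) ^ n / (fact n)\<^sup>2) * 1"
      using x L M(2) \<delta> by (intro mult_left_mono powr_le1) auto
    finally show "\<bar>u 0 x - x powr (if \<alpha> < 1 then 1 - \<alpha> else 0) * poly P (x powr (2 - \<alpha>))\<bar>
            \<le> M * L ^ n * ((2 / (2 - \<alpha>)\<^sup>2) ^ n / (fact n)\<^sup>2)"
      by (simp add: s_def \<delta>_def)
  qed
qed

section \<open>Interpolation at separated nodes\<close>

text \<open>A single term of the exponential series. With x = k it stands in for Stirling's formula:
  k^k / k! \<le> e^k.\<close>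

lemma power_div_fact_le_exp:
  fixes x :: real
  assumes "0 \<le> x"
  shows "x ^ k / fact k \<le> exp x"
proof -
  have s: "(\<lambda>k. x ^ k /\<^sub>R fact k) sums exp x"
    by (rule exp_converges)
  have "(\<Sum>k\<in>{k}. x ^ k /\<^sub>R fact k) \<le> (\<Sum>k. x ^ k /\<^sub>R fact k)"
    using s assms by (intro sum_le_suminf) (auto simp: sums_iff)
  then show ?thesis
    using s by (simp add: sums_iff divide_inverse_commute)
qed

lemma lagrange_interpolation:
  fixes P :: "real poly"
  assumes "degree P < n" and inj: "inj_on y {..<n}"
  shows "poly P z = (\<Sum>i<n. poly P (y i) * (\<Prod>k\<in>{..<n} - {i}. (z - y k) / (y i - y k)))"
proof -
  define l where "l i = (\<Prod>k\<in>{..<n} - {i}. smult (1 / (y i - y k)) [:- y k, 1:])" for i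
  define Q where "Q = (\<Sum>i<n. smult (poly P (y i)) (l i))"
  have pl: "poly (l i) t = (\<Prod>k\<in>{..<n} - {i}. (t - y k) / (y i - y k))" for i t
    unfolding l_def poly_prod by (intro prod.cong refl) (simp add: diff_divide_distrib)
  have "degree (l i) \<le> n - 1" if "i < n" for i
  proof -
    have "degree (l i) \<le> (\<Sum>k\<in>{..<n} - {i}. degree (smult (1 / (y i - y k)) [:- y k, 1:]))"
      unfolding l_def by (rule order_trans[OF degree_prod_sum_le]) (simp_all only: o_def finite_Diff finite_lessThan order_refl)
    also have "\<dots> \<le> (\<Sum>k\<in>{..<n} - {i}. 1)"
      by (intro sum_mono order_trans[OF degree_smult_le]) simp
    also have "\<dots> = n - 1" using that by simp
    finally show ?thesis .
  qed
  then have "degree Q \<le> n - 1"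
    unfolding Q_def by (intro degree_sum_le) (auto intro: order_trans[OF degree_smult_le])
  then have "degree Q < n" using assms(1) by simp
  moreover have "poly P t = poly Q t" if t: "t \<in> y ` {..<n}" for t
  proof -
    obtain j where j: "j < n" "t = y j" using t by auto
    have "poly (l i) (y j) = (if i = j then 1 else 0)" if "i < n" for i
    proof (cases "i = j")
      case True
      have "(y j - y k) / (y j - y k) = 1" if "k \<in> {..<n} - {j}" for k
        using inj that j by (auto simp: inj_on_def)
      then show ?thesis using True by (simp add: pl)
    next
      case False
      then show ?thesis using j that unfolding pl by (auto intro!: prod_zero)
    qed
    then have "poly Q t = (\<Sum>i<n. poly P (y i) * (if i = j then 1 else 0))"
      unfolding Q_def poly_sum j(2) by (intro sum.cong refl) simp
    also have "\<dots> = poly P t" using j by (simp add: if_distrib sum.delta cong: if_cong)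
    finally show ?thesis by simp
  qed
  moreover have "card (y ` {..<n}) = n" using inj by (simp add: card_image)
  ultimately have "P = Q"
    using assms(1) by (intro poly_eqI_degree[of "y ` {..<n}"]) auto
  then have "poly P z = poly Q z" by simp
  also have "\<dots> = (\<Sum>i<n. poly P (y i) * (\<Prod>k\<in>{..<n} - {i}. (z - y k) / (y i - y k)))"
    unfolding Q_def by (simp add: poly_sum pl)
  finally show ?thesis .
qed

text \<open>Lagrange denominators at the model nodes 0, ..., n-1. The two factorials turn the sum
  over the nodes into a row of binomial coefficients.\<close>

lemma prod_abs_diff_eq_fact:
  assumes "i < n"
  shows "(\<Prod>k\<in>{..<n} - {i}. \<bar>real i - real k\<bar>) = fact i * fact (n - 1 - i)"
proof -
  have eq: "{..<n} - {i} = {..<i} \<union> {Suc i..<n}" using assms by auto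
  have "(\<Prod>k\<in>{..<n} - {i}. \<bar>real i - real k\<bar>) =
      (\<Prod>k<i. \<bar>real i - real k\<bar>) * (\<Prod>k\<in>{Suc i..<n}. \<bar>real i - real k\<bar>)"
    unfolding eq by (rule prod.union_disjoint) auto
  also have "(\<Prod>k<i. \<bar>real i - real k\<bar>) = (\<Prod>k<i. real (Suc (i - Suc k)))"
    by (intro prod.cong) auto
  also have "\<dots> = (\<Prod>k<i. real (Suc k))"
    by (rule prod.nat_diff_reindex)
  also have "\<dots> = fact i"
    by (simp add: fact_prod_Suc atLeast0LessThan)
  also have "(\<Prod>k\<in>{Suc i..<n}. \<bar>real i - real k\<bar>) = (\<Prod>k<n - 1 - i. real (Suc k))"
    using assms by (intro prod.reindex_bij_witness[of _ "\<lambda>k. k + Suc i" "\<lambda>k. k - Suc i"]) auto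
  also have "\<dots> = fact (n - 1 - i)"
    by (simp add: fact_prod_Suc atLeast0LessThan)
  finally show ?thesis .
qed

text \<open>The i-th Lagrange denominator is at least (h/n)^(n-1) i! (n-1-i)! and the numerators are
  at most 1. Summing over i gives (2n/h)^(n-1) / (n-1)!, which equals (2/h)^(n-1) n^n / n!, and n^n
  / n! \<le> e^n. The loss is thus only exponential in n.\<close>

lemma poly_bound_from_separated_nodes:
  fixes P :: "real poly"
  assumes deg: "degree P < n" and h: "0 < h" "h \<le> 1"
    and y: "\<And>i. i < n \<Longrightarrow> y i \<in> {0..1}"
    and sep: "\<And>i k. i < k \<Longrightarrow> k < n \<Longrightarrow> h * (real k - real i) / real n \<le> y k - y i"
    and W: "\<And>i. i < n \<Longrightarrow> \<bar>poly P (y i)\<bar> \<le> W" and z: "z \<in> {0..1}"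
  shows "\<bar>poly P z\<bar> \<le> (2 * exp 1 / h) ^ n * W"
proof -
  have "0 < n" using deg by simp
  have sep': "h / real n * \<bar>real i - real k\<bar> \<le> \<bar>y i - y k\<bar>" if "i < n" "k < n" for i k
    using sep[of i k] sep[of k i] that by (cases i k rule: linorder_cases) auto
  have inj: "inj_on y {..<n}"
  proof (rule inj_onI)
    fix i k assume ik: "i \<in> {..<n}" "k \<in> {..<n}" "y i = y k"
    show "i = k"
    proof (rule ccontr)
      assume "i \<noteq> k"
      then have "0 < h / real n * \<bar>real i - real k\<bar>" using h \<open>0 < n\<close> by simp
      with sep'[of i k] ik show False by simp
    qed
  qed
  have "0 \<le> W" using W[OF \<open>0 < n\<close>] by simp
  define K where "K = (real n / h) ^ (n - 1)"
  have tm: "\<bar>\<Prod>k\<in>{..<n} - {i}. (z - y k) / (y i - y k)\<bar> \<le> K / (fact i * fact (n - 1 - i))" if i: "i < n" for i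
  proof -
    have "\<bar>\<Prod>k\<in>{..<n} - {i}. (z - y k) / (y i - y k)\<bar> = (\<Prod>k\<in>{..<n} - {i}. \<bar>z - y k\<bar> / \<bar>y i - y k\<bar>)"
      by (simp add: abs_prod abs_divide)
    also have "\<dots> \<le> (\<Prod>k\<in>{..<n} - {i}. (real n / h) / \<bar>real i - real k\<bar>)"
    proof (intro prod_mono conjI)
      fix k assume k: "k \<in> {..<n} - {i}"
      have pos: "0 < h / real n * \<bar>real i - real k\<bar>" using k h \<open>0 < n\<close> by simp
      have "\<bar>z - y k\<bar> \<le> 1" using z y[of k] k by auto
      then have "\<bar>z - y k\<bar> / \<bar>y i - y k\<bar> \<le> 1 / (h / real n * \<bar>real i - real k\<bar>)"
        using sep'[of i k] pos i k by (intro frac_le) auto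
      then show "\<bar>z - y k\<bar> / \<bar>y i - y k\<bar> \<le> (real n / h) / \<bar>real i - real k\<bar>" by simp
    qed simp
    also have "\<dots> = K / (\<Prod>k\<in>{..<n} - {i}. \<bar>real i - real k\<bar>)"
      unfolding prod_dividef prod_constant K_def using i by (simp add: power_divide)
    finally show ?thesis unfolding prod_abs_diff_eq_fact[OF i] .
  qed
  have "\<bar>poly P z\<bar> \<le> (\<Sum>i<n. \<bar>poly P (y i) * (\<Prod>k\<in>{..<n} - {i}. (z - y k) / (y i - y k))\<bar>)"
    unfolding lagrange_interpolation[OF deg inj, of z] by (rule sum_abs)
  also have "\<dots> \<le> (\<Sum>i<n. W * (K / (fact i * fact (n - 1 - i))))"
    unfolding abs_mult using W tm \<open>0 \<le> W\<close> by (intro sum_mono mult_mono) auto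
  also have "\<dots> = (\<Sum>i\<le>n - 1. W * K / fact (n - 1) * real ((n - 1) choose i))"
  proof (rule sum.cong)
    show "{..<n} = {..n - 1}" using \<open>0 < n\<close> by auto
    fix i assume "i \<in> {..n - 1}"
    then show "W * (K / (fact i * fact (n - 1 - i))) = W * K / fact (n - 1) * real ((n - 1) choose i)"
      by (simp add: binomial_fact)
  qed
  also have "\<dots> = W * K / fact (n - 1) * 2 ^ (n - 1)"
    unfolding sum_distrib_left[symmetric] of_nat_sum[symmetric] choose_row_sum by simp
  also have "\<dots> = W * ((2 / h) ^ (n - 1) * (real n ^ n / fact n))"
  proof -
    have "fact n = real n * fact (n - 1)" "real n ^ n = real n * real n ^ (n - 1)"
      using \<open>0 < n\<close> by (simp_all add: fact_reduce power_eq_if)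
    then show ?thesis
      using \<open>0 < n\<close> by (simp add: K_def power_divide)
  qed
  also have "\<dots> \<le> W * ((2 / h) ^ n * exp (real n))"
    using \<open>0 \<le> W\<close> h by (intro mult_left_mono mult_mono power_div_fact_le_exp[OF of_nat_0_le_iff] power_increasing) auto
  also have "\<dots> = (2 * exp 1 / h) ^ n * W"
    by (simp add: exp_of_nat_mult[of n 1, simplified] power_divide power_mult_distrib mult_ac)
  finally show ?thesis .
qed

section \<open>The spectral inequality\<close>

text \<open>The minimum over [c,d] is at most the mean. The nodes are chosen this way, trading the
  integral over \<omega> for point values.\<close>

lemma exists_point_le_set_integral:
  fixes f :: "real \<Rightarrow> real"
  assumes int: "set_integrable lebesgue \<omega> f" and nn: "\<And>x. 0 \<le> f x"
    and sub: "{c..d} \<subseteq> \<omega>" and "c < d" and cont: "continuous_on {c..d} f"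
  shows "\<exists>x\<in>{c..d}. (d - c) * f x \<le> (LINT x:\<omega>|lebesgue. f x)"
proof -
  obtain x where x: "x \<in> {c..d}" "\<And>y. y \<in> {c..d} \<Longrightarrow> f x \<le> f y"
    using continuous_attains_inf[OF compact_Icc _ cont] \<open>c < d\<close> by auto
  have "(d - c) * f x = integral {c..d} (\<lambda>_. f x)"
    using \<open>c < d\<close> by simp
  also have "\<dots> \<le> integral {c..d} f"
    using x(2) cont by (intro integral_le integrable_continuous_interval) auto
  also have "\<dots> \<le> integral \<omega> f"
    using sub nn cont int
    by (intro integral_subset_le integrable_continuous_interval) (auto intro: set_lebesgue_integral_eq_integral(1))
  also have "\<dots> = (LINT x:\<omega>|lebesgue. f x)"
    using set_lebesgue_integral_eq_integral(2)[OF int] by simp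
  finally show ?thesis using x(1) by blast
qed

text \<open>For n \<ge> B sqrt L one has L \<le> n^2/B^2, and n^n / n! \<le> e^n bounds L^n/(n!)^2
  by (e^2/B^2)^n; the factor L^m costs a constant times e^n. So B can be chosen independently of L
  and n. The factor 4 is what leaves half of A after absorption.\<close>

lemma remainder_smallness:
  fixes C K a q :: real
  assumes "0 \<le> C" "0 < K" "0 < a" "0 < q"
  shows "\<exists>B\<ge>1. \<forall>L>0. \<forall>n\<ge>1. B * sqrt L \<le> real n \<longrightarrow>
           4 * (K ^ n / a) * (C * L ^ m * L ^ n * (q ^ n / (fact n)\<^sup>2)) \<le> 1"
proof -
  \<comment> \<open>\<open>X\<close> and \<open>Y\<close> gather the constants and the bases, so
    that the left side is at most X (Y/B^2)^n; then B^2 \<ge> Y(X+1) brings it down to X/(X+1),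
    because n \<ge> 1.\<close>
  define X where "X = 4 * C * fact (2 * m) / a"
  have "0 \<le> X" using assms by (simp add: X_def)
  define Y where "Y = K * q * exp 3"
  have "0 < Y" using assms by (simp add: Y_def)
  define B where "B = max 1 (sqrt (Y * (X + 1)))"
  have B: "1 \<le> B" "Y * (X + 1) \<le> B\<^sup>2"
  proof -
    show "1 \<le> B" by (simp add: B_def)
    have "(sqrt (Y * (X + 1)))\<^sup>2 \<le> B\<^sup>2"
      unfolding B_def using \<open>0 < Y\<close> \<open>0 \<le> X\<close> by (intro power_mono) auto
    then show "Y * (X + 1) \<le> B\<^sup>2" using \<open>0 < Y\<close> \<open>0 \<le> X\<close> by simp
  qed
  show ?thesis
  proof (intro exI[of _ B] conjI allI impI B(1))
    fix L :: real and n :: nat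
    assume "0 < L" "1 \<le> n" and Bn: "B * sqrt L \<le> real n"
    have L: "L \<le> (real n)\<^sup>2 / B\<^sup>2"
    proof -
      have "(B * sqrt L)\<^sup>2 \<le> (real n)\<^sup>2" using Bn B(1) \<open>0 < L\<close> by (intro power_mono) auto
      then show ?thesis using B(1) \<open>0 < L\<close> by (simp add: power_mult_distrib field_simps)
    qed
    have Lm: "L ^ m \<le> fact (2 * m) * exp (real n)"
    proof -
      have "(real n)\<^sup>2 / B\<^sup>2 \<le> (real n)\<^sup>2 / 1"
        using B(1) by (intro divide_left_mono) auto
      then have "L \<le> (real n)\<^sup>2" using L by simp
      then have "L ^ m \<le> real n ^ (2 * m)" using \<open>0 < L\<close> by (simp add: power_mono power_mult)
      also have "\<dots> \<le> fact (2 * m) * exp (real n)"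
        using power_div_fact_le_exp[of "real n" "2 * m"] by (simp add: field_simps)
      finally show ?thesis .
    qed
    have Ln: "L ^ n / (fact n)\<^sup>2 \<le> (exp 2 / B\<^sup>2) ^ n"
    proof -
      have "L ^ n / (fact n)\<^sup>2 \<le> ((real n)\<^sup>2 / B\<^sup>2) ^ n / (fact n)\<^sup>2"
        using L \<open>0 < L\<close> by (intro divide_right_mono power_mono) auto
      also have "\<dots> = (1 / B\<^sup>2) ^ n * (real n ^ n / fact n)\<^sup>2"
        by (simp add: power_divide power2_eq_square power_mult_distrib)
      also have "\<dots> \<le> (1 / B\<^sup>2) ^ n * (exp (real n))\<^sup>2"
        by (intro mult_left_mono power_mono power_div_fact_le_exp) auto
      also have "(exp (real n))\<^sup>2 = exp 2 ^ n"
        by (simp flip: exp_of_nat_mult exp_double add: mult.commute)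
      also have "(1 / B\<^sup>2) ^ n * exp 2 ^ n = (exp 2 / B\<^sup>2) ^ n"
        by (simp flip: power_mult_distrib)
      finally show ?thesis .
    qed
    have "4 * (K ^ n / a) * (C * L ^ m * L ^ n * (q ^ n / (fact n)\<^sup>2))
        = 4 * C / a * (K * q) ^ n * (L ^ m * (L ^ n / (fact n)\<^sup>2))"
      by (simp add: power_mult_distrib)
    also have "\<dots> \<le> 4 * C / a * (K * q) ^ n * ((fact (2 * m) * exp (real n)) * (exp 2 / B\<^sup>2) ^ n)"
      using assms \<open>0 < L\<close> by (intro mult_left_mono mult_mono Lm Ln) auto
    also have "\<dots> = X * (Y / B\<^sup>2) ^ n"
    proof -
      have "exp (real n) * exp 2 ^ n = (exp 3 :: real) ^ n"
      proof -
        have "exp (real n) = (exp 1 :: real) ^ n" by (simp flip: exp_of_nat_mult)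
        moreover have "exp 1 * exp 2 = (exp 3 :: real)" by (simp flip: exp_add)
        ultimately show ?thesis by (simp flip: power_mult_distrib)
      qed
      then show ?thesis by (simp add: X_def Y_def power_mult_distrib power_divide mult_ac)
    qed
    also have "\<dots> \<le> X * (1 / (X + 1)) ^ n"
    proof -
      have "Y / B\<^sup>2 \<le> 1 / (X + 1)"
        using B \<open>0 \<le> X\<close> by (simp add: field_simps)
      then show ?thesis
        using \<open>0 \<le> X\<close> \<open>0 < Y\<close> by (intro mult_left_mono power_mono) auto
    qed
    also have "\<dots> \<le> X * (1 / (X + 1)) ^ 1"
      using \<open>0 \<le> X\<close> \<open>1 \<le> n\<close> by (intro mult_left_mono power_decreasing) auto
    also have "\<dots> \<le> 1" using \<open>0 \<le> X\<close> by (simp add: field_simps)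
    finally show "4 * (K ^ n / a) * (C * L ^ m * L ^ n * (q ^ n / (fact n)\<^sup>2)) \<le> 1" .
  qed
qed

text \<open>On (0,1), \<delta> < 2 gives t^(\<delta>-1) \<ge> t \<ge> a, so the derivative is at
  least \<delta>a. This carries separation of points over to x^\<delta>, the variable of the
  polynomial.\<close>

lemma powr_diff_ge:
  assumes "0 < a" "a \<le> x" "x \<le> y" "y < 1" "0 < \<delta>" "\<delta> < (2::real)"
  shows "\<delta> * a * (y - x) \<le> y powr \<delta> - x powr \<delta>"
proof -
  have "x powr \<delta> - \<delta> * a * x \<le> y powr \<delta> - \<delta> * a * y"
  proof (rule DERIV_nonneg_imp_nondecreasing[OF \<open>x \<le> y\<close>])
    fix t assume t: "x \<le> t" "t \<le> y"
    have "a \<le> t powr 1" using t assms by simp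
    also have "\<dots> \<le> t powr (\<delta> - 1)" using t assms by (intro powr_mono') auto
    finally have "\<delta> * a \<le> \<delta> * t powr (\<delta> - 1)" using assms by simp
    then show "\<exists>z. ((\<lambda>t. t powr \<delta> - \<delta> * a * t) has_real_derivative z) (at t) \<and> 0 \<le> z"
      using t assms by (intro exI[of _ "\<delta> * t powr (\<delta> - 1) - \<delta> * a"] conjI) (auto intro!: derivative_eq_intros)
  qed
  then show ?thesis by (simp add: algebra_simps)
qed

text \<open>Averaging yields points of [a,b] where u is small; their \<delta>-th powers, \<delta> =
  2-\<alpha>, are the interpolation nodes. The remainder \<rho> enters twice, at the nodes and at
  x.\<close>

lemma spectral_chain_pointwise_bound:
  assumes \<alpha>: "0 < \<alpha>" "\<alpha> < 2" and ab: "0 < a" "a < b" "b < 1" "{a..b} \<subseteq> \<omega>"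
    and ch: "spectral_chain \<alpha> L A u p" and AL: "0 \<le> A" "0 \<le> L"
    and M: "\<And>k x. x \<in> {0<..<1} \<Longrightarrow> \<bar>u k x\<bar> \<le> M * L ^ k" "0 \<le> M" and n: "0 < n"
    and int: "set_integrable lebesgue \<omega> (\<lambda>x. (u 0 x)\<^sup>2)" and x: "x \<in> {0<..<1}"
  defines "h \<equiv> (2 - \<alpha>) * a * (b - a) / 2"
    and "\<rho> \<equiv> M * L ^ n * ((2 / (2 - \<alpha>)\<^sup>2) ^ n / (fact n)\<^sup>2)"
  shows "\<bar>u 0 x\<bar> \<le> (2 * exp 1 / h) ^ n / a *
            (sqrt (2 * real n / (b - a) * (LINT x:\<omega>|lebesgue. (u 0 x)\<^sup>2)) + 2 * \<rho>)"
proof -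
  define \<delta> where "\<delta> = 2 - \<alpha>"
  have \<delta>: "0 < \<delta>" "\<delta> < 2" using \<alpha> by (auto simp: \<delta>_def)
  define s where "s = (if \<alpha> < 1 then 1 - \<alpha> else 0)"
  have s: "0 \<le> s" "s \<le> 1" using \<alpha> by (auto simp: s_def)
  define J where "J = (LINT x:\<omega>|lebesgue. (u 0 x)\<^sup>2)"
  define W where "W = sqrt (2 * real n / (b - a) * J)"
  obtain P where P: "degree P < n"
    "\<And>x. x \<in> {0<..<1} \<Longrightarrow> \<bar>u 0 x - x powr s * poly P (x powr \<delta>)\<bar> \<le> \<rho>"
    using spectral_chain_expansion[OF \<alpha> ch AL(2) M n] unfolding s_def \<delta>_def \<rho>_def by blast
  have "0 \<le> \<rho>" using P(2)[OF x] by simp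
  have h: "0 < h" "h \<le> 1"
  proof -
    show "0 < h" using ab \<delta> by (simp add: h_def \<delta>_def[symmetric])
    have "\<delta> * a * (b - a) \<le> 2 * 1 * 1" using ab \<delta> by (intro mult_mono) auto
    then show "h \<le> 1" by (simp add: h_def \<delta>_def)
  qed
  \<comment> \<open>Of 2n equal pieces of [a,b] every other one receives a point, so the pieces
    between them force a distance of at least (k-i)l. By \<open>powr_diff_ge\<close> this is the
    separation with h = \<delta>a(b-a)/2.\<close>
  define l where "l = (b - a) / (2 * real n)"
  have l: "0 < l" using ab n by (simp add: l_def)
  define I where "I i = {a + 2 * real i * l..a + (2 * real i + 1) * l}" for i
  have ex: "\<exists>t\<in>I i. l * (u 0 t)\<^sup>2 \<le> J \<and> t \<in> {a..b}" if i: "i < n" for i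
  proof -
    have "(2 * real i + 1) * l \<le> 2 * real n * l"
      using i l by (intro mult_right_mono) auto
    also have "\<dots> = b - a" using n by (simp add: l_def)
    finally have sub: "I i \<subseteq> {a..b}"
      using l by (auto simp: I_def)
    have c: "continuous_on (I i) (u 0)"
    proof (rule DERIV_continuous_on)
      fix t assume "t \<in> I i"
      then have "t \<in> {a..b}" using sub by blast
      then have "t \<in> {0<..<1}" using ab by auto
      from spectral_chainD(1)[OF ch this, of 0]
      show "(u 0 has_real_derivative t powr (-\<alpha>) * p 0 t) (at t within I i)"
        by (rule has_field_derivative_at_within)
    qed
    have len: "a + (2 * real i + 1) * l - (a + 2 * real i * l) = l" by (simp add: algebra_simps)
    have "\<exists>t\<in>I i. (a + (2 * real i + 1) * l - (a + 2 * real i * l)) * (u 0 t)\<^sup>2 \<le> J"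
      unfolding J_def I_def
    proof (rule exists_point_le_set_integral[OF int])
      show "{a + 2 * real i * l..a + (2 * real i + 1) * l} \<subseteq> \<omega>"
        using sub ab(4) unfolding I_def by blast
      show "a + 2 * real i * l < a + (2 * real i + 1) * l" using len l by linarith
      show "continuous_on {a + 2 * real i * l..a + (2 * real i + 1) * l} (\<lambda>x. (u 0 x)\<^sup>2)"
        using c unfolding I_def by (rule continuous_on_power)
    qed simp
    then show ?thesis using sub unfolding len by blast
  qed
  then obtain t where t: "\<And>i. i < n \<Longrightarrow> t i \<in> I i"
    "\<And>i. i < n \<Longrightarrow> l * (u 0 (t i))\<^sup>2 \<le> J" "\<And>i. i < n \<Longrightarrow> t i \<in> {a..b}"
    by metis
  have t01: "t i \<in> {0<..<1}" if "i < n" for i using t(3)[OF that] ab by auto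
  have sep: "h * (real k - real i) / real n \<le> t k powr \<delta> - t i powr \<delta>" if ik: "i < k" "k < n" for i k
  proof -
    have "(2 * real i + 1) * l + (real k - real i) * l \<le> 2 * real k * l"
      unfolding distrib_right[symmetric] using ik l by (intro mult_right_mono) auto
    then have d: "(real k - real i) * l \<le> t k - t i"
      using t(1)[of k] t(1)[of i] ik unfolding I_def by auto
    have "h * (real k - real i) / real n = \<delta> * a * ((real k - real i) * l)"
      by (simp add: h_def l_def \<delta>_def)
    also have "\<dots> \<le> \<delta> * a * (t k - t i)"
      using d \<delta> ab by (intro mult_left_mono) auto
    also have "\<dots> \<le> t k powr \<delta> - t i powr \<delta>"
    proof (rule powr_diff_ge)
      have "0 \<le> (real k - real i) * l" using ik l by simp
      then show "t i \<le> t k" using d by linarith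
    qed (use t(3) t01 ik ab \<delta> in \<open>auto simp: less_imp_le\<close>)
    finally show ?thesis .
  qed
  have node: "\<bar>poly P (t i powr \<delta>)\<bar> \<le> (W + \<rho>) / a" if i: "i < n" for i
  proof -
    have "(u 0 (t i))\<^sup>2 \<le> 2 * real n / (b - a) * J"
      using t(2)[OF i] ab n by (simp add: l_def field_simps)
    then have "\<bar>u 0 (t i)\<bar> \<le> W"
      unfolding W_def by (metis real_sqrt_abs real_sqrt_le_mono)
    moreover have "\<bar>t i powr s * poly P (t i powr \<delta>)\<bar> \<le> \<bar>u 0 (t i)\<bar> + \<rho>"
      using P(2)[OF t01[OF i]] by linarith
    moreover have "a * \<bar>poly P (t i powr \<delta>)\<bar> \<le> \<bar>t i powr s * poly P (t i powr \<delta>)\<bar>"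
    proof -
      \<comment> \<open>Since s \<le> 1, the weight x^s is at least a at the nodes and can be
        divided out.\<close>
      have "a \<le> t i powr 1" using t(3)[OF i] ab by simp
      also have "\<dots> \<le> t i powr s" using t01[OF i] s by (intro powr_mono') auto
      finally show ?thesis by (simp add: abs_mult mult_right_mono)
    qed
    ultimately have "a * \<bar>poly P (t i powr \<delta>)\<bar> \<le> W + \<rho>" by linarith
    then show ?thesis using ab by (simp add: field_simps)
  qed
  define K where "K = 2 * exp 1 / h"
  have K: "1 \<le> K"
  proof -
    have "1 \<le> 2 * exp (1::real)" using exp_ge_add_one_self[of "1::real"] by linarith
    then show ?thesis unfolding K_def using h by (simp add: le_divide_eq)
  qed
  have "\<bar>poly P (x powr \<delta>)\<bar> \<le> K ^ n * ((W + \<rho>) / a)"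
    unfolding K_def
  proof (rule poly_bound_from_separated_nodes[OF P(1) h, of "\<lambda>i. t i powr \<delta>"])
    show "t i powr \<delta> \<in> {0..1}" if "i < n" for i
      using t01[OF that] \<delta> by (auto intro: powr_le1)
    show "x powr \<delta> \<in> {0..1}" using x \<delta> by (auto intro: powr_le1)
  qed (use sep node in auto)
  moreover have "\<bar>x powr s * poly P (x powr \<delta>)\<bar> \<le> 1 * \<bar>poly P (x powr \<delta>)\<bar>"
    unfolding abs_mult using x s by (intro mult_right_mono) (auto intro: powr_le1)
  \<comment> \<open>Weakened so that the error at x joins the one at the nodes under a common
    factor.\<close>
  moreover have "\<rho> \<le> K ^ n * (\<rho> / a)"
  proof -
    have "1 * \<rho> \<le> K ^ n * (\<rho> / a)"
      using K \<open>0 \<le> \<rho>\<close> ab by (intro mult_mono one_le_power) (auto simp: field_simps mult_left_le)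
    then show ?thesis by simp
  qed
  ultimately have "\<bar>u 0 x\<bar> \<le> K ^ n * ((W + \<rho>) / a) + K ^ n * (\<rho> / a)"
    using P(2)[OF x] by linarith
  also have "\<dots> = K ^ n / a * (W + 2 * \<rho>)"
    by (simp add: add_divide_distrib distrib_left)
  finally show ?thesis
    unfolding K_def W_def J_def .
qed

text \<open>As (0,1) has length 1, the pointwise bound also bounds A. Its remainder carries the
  factor A through M, so for n about B sqrt L it contributes at most A/2 and is absorbed. What is
  left is K^n with n of order sqrt L.\<close>

lemma spectral_chain_observability:
  assumes \<alpha>: "0 < \<alpha>" "\<alpha> < 2" and ab: "0 < a" "a < b" "b < 1" "{a..b} \<subseteq> \<omega>"
  shows "\<exists>C>0. \<forall>L A u p. 0 < L \<longrightarrow> 0 \<le> A \<longrightarrow> spectral_chain \<alpha> L A u p \<longrightarrow> A\<^sup>2 \<le> (\<integral>x. (u 0 x)\<^sup>2 \<partial>leb01) \<longrightarrow>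
           set_integrable lebesgue \<omega> (\<lambda>x. (u 0 x)\<^sup>2) \<longrightarrow>
           A\<^sup>2 \<le> C * exp (C * sqrt L) * (LINT x:\<omega>|lebesgue. (u 0 x)\<^sup>2)"
proof -
  obtain C0 m where C0: "\<And>L A u p x. x \<in> {0<..<1} \<Longrightarrow> spectral_chain \<alpha> L A u p \<Longrightarrow> 0 \<le> A \<Longrightarrow> 0 \<le> L \<Longrightarrow>
      \<bar>u 0 x\<bar> \<le> C0 * (L ^ m * A)"
    using spectral_chain_bounded[OF \<alpha>] by blast
  define h where "h = (2 - \<alpha>) * a * (b - a) / 2"
  define K where "K = 2 * exp 1 / h"
  define q where "q = 2 / (2 - \<alpha>)\<^sup>2"
  have h: "0 < h" "h \<le> 1"
  proof -
    show "0 < h" using ab \<alpha> by (simp add: h_def)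
    have "(2 - \<alpha>) * a * (b - a) \<le> 2 * 1 * 1" using ab \<alpha> by (intro mult_mono) auto
    then show "h \<le> 1" by (simp add: h_def)
  qed
  have K: "1 \<le> K"
  proof -
    have "1 \<le> 2 * exp (1::real)" using exp_ge_add_one_self[of "1::real"] by linarith
    then show ?thesis unfolding K_def using h by (simp add: le_divide_eq)
  qed
  have q: "0 < q" using \<alpha> by (simp add: q_def)
  have "0 < K" using K by simp
  obtain B where B: "1 \<le> B" and small: "\<And>L n. 0 < L \<Longrightarrow> 1 \<le> n \<Longrightarrow> B * sqrt L \<le> real n \<Longrightarrow>
      4 * (K ^ n / a) * (\<bar>C0\<bar> * L ^ m * L ^ n * (q ^ n / (fact n)\<^sup>2)) \<le> 1"
    using remainder_smallness[OF abs_ge_zero \<open>0 < K\<close> ab(1) q, of C0 m] by blast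
  \<comment> \<open>n K^(2n) \<le> exp(gn), and n \<le> B sqrt L + 1 yields the factors exp(g) and
    exp(gB sqrt L). \<open>G\<close> collects the constants of (2 K^n W / a)^2.\<close>
  define g where "g = 1 + 2 * ln K"
  have g: "1 \<le> g" using K by (simp add: g_def)
  define G where "G = 8 / (a\<^sup>2 * (b - a))"
  have G: "0 < G" using ab by (simp add: G_def)
  define C where "C = G * exp g + g * B"
  have "0 < G * exp g" "0 < g * B" using G g B by simp_all
  then have C: "0 < C" "G * exp g \<le> C" "g * B \<le> C" by (simp_all add: C_def)
  have main: "A\<^sup>2 \<le> C * exp (C * sqrt L) * (LINT x:\<omega>|lebesgue. (u 0 x)\<^sup>2)"
    if L: "0 < L" and A: "0 \<le> A" and ch: "spectral_chain \<alpha> L A u p" and le: "A\<^sup>2 \<le> (\<integral>x. (u 0 x)\<^sup>2 \<partial>leb01)"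
      and int: "set_integrable lebesgue \<omega> (\<lambda>x. (u 0 x)\<^sup>2)" for L A u p
  proof -
    define J where "J = (LINT x:\<omega>|lebesgue. (u 0 x)\<^sup>2)"
    have "0 \<le> J"
      unfolding J_def set_lebesgue_integral_def by (intro Bochner_Integration.integral_nonneg) (simp add: indicator_def)
    define n where "n = nat \<lceil>B * sqrt L\<rceil>"
    have pos: "0 < B * sqrt L" using B L by simp
    then have n: "1 \<le> n" "B * sqrt L \<le> real n" "real n \<le> B * sqrt L + 1"
      unfolding n_def by (linarith, linarith, linarith)
    define M where "M = \<bar>C0\<bar> * (L ^ m * A)"
    have M: "\<bar>u k x\<bar> \<le> M * L ^ k" if "x \<in> {0<..<1}" for k x
    proof -
      have "\<bar>u k x\<bar> \<le> C0 * (L ^ m * (A * L ^ k))"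
        using C0[OF that spectral_chain_shift[OF ch, of k]] A L by simp
      also have "\<dots> \<le> \<bar>C0\<bar> * (L ^ m * (A * L ^ k))"
        using A L by (intro mult_right_mono) auto
      finally show ?thesis by (simp add: M_def mult_ac)
    qed
    have "0 \<le> M" using A L by (simp add: M_def)
    define \<rho> where "\<rho> = M * L ^ n * (q ^ n / (fact n)\<^sup>2)"
    define W where "W = sqrt (2 * real n / (b - a) * J)"
    define T where "T = K ^ n / a * (W + 2 * \<rho>)"
    have T: "\<bar>u 0 x\<bar> \<le> T" if x: "x \<in> {0<..<1}" for x
      unfolding T_def W_def K_def h_def J_def \<rho>_def q_def
      using n(1) L by (intro spectral_chain_pointwise_bound[OF \<alpha> ab ch A _ M \<open>0 \<le> M\<close> _ int x]) auto
    have "0 \<le> T" using T[of "1/2"] by simp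
    have "A\<^sup>2 \<le> (\<integral>x. T\<^sup>2 \<partial>leb01)"
    proof (rule order_trans[OF le], rule integral_mono_AE[OF spectral_chainD(6)[OF ch]])
      show "integrable leb01 (\<lambda>x. T\<^sup>2)"
        by (auto simp: integrable_restrict_space lmeasurable_iff_integrable[symmetric] intro!: integrable_mult_right)
      show "AE x in leb01. (u 0 x)\<^sup>2 \<le> T\<^sup>2"
      proof (rule AE_I2)
        fix x assume "x \<in> space leb01"
        then have "\<bar>u 0 x\<bar> \<le> T" by (intro T) (simp add: space_restrict_space)
        then show "(u 0 x)\<^sup>2 \<le> T\<^sup>2" by (simp add: abs_le_square_iff[symmetric])
      qed
    qed
    also have "\<dots> = T\<^sup>2"
      by (simp add: measure_restrict_space space_restrict_space)
    finally have "A \<le> T"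
      using \<open>0 \<le> T\<close> by (rule power2_le_imp_le)
    moreover have "K ^ n / a * (2 * \<rho>) \<le> A / 2"
    proof -
      have "K ^ n / a * (2 * \<rho>) = A / 2 * (4 * (K ^ n / a) * (\<bar>C0\<bar> * L ^ m * L ^ n * (q ^ n / (fact n)\<^sup>2)))"
        by (simp add: \<rho>_def M_def)
      also have "\<dots> \<le> A / 2 * 1"
        using small[OF L n(1,2)] A by (intro mult_left_mono) auto
      finally show ?thesis by simp
    qed
    ultimately have "A \<le> 2 * (K ^ n / a) * W"
      unfolding T_def distrib_left by linarith
    then have "A\<^sup>2 \<le> (2 * (K ^ n / a) * W)\<^sup>2"
      using A by (rule power_mono)
    also have "\<dots> = 4 * (K ^ n)\<^sup>2 / a\<^sup>2 * W\<^sup>2"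
      by (simp add: power_mult_distrib power_divide)
    also have "W\<^sup>2 = 2 * real n / (b - a) * J"
      unfolding W_def using ab \<open>0 \<le> J\<close> by (intro real_sqrt_pow2) auto
    also have "4 * (K ^ n)\<^sup>2 / a\<^sup>2 * (2 * real n / (b - a) * J) = G * (real n * (K ^ n)\<^sup>2) * J"
      by (simp add: G_def)
    also have "\<dots> \<le> C * exp (C * sqrt L) * J"
    proof (intro mult_right_mono \<open>0 \<le> J\<close>)
      have "K ^ n = exp (real n * ln K)"
        using K by (simp add: exp_of_nat_mult)
      then have "(K ^ n)\<^sup>2 = exp (2 * real n * ln K)"
        by (simp add: power2_eq_square flip: exp_add)
      moreover have "real n \<le> exp (real n)"
        using exp_ge_add_one_self[of "real n"] by linarith
      ultimately have "real n * (K ^ n)\<^sup>2 \<le> exp (real n) * exp (2 * real n * ln K)"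
        by (simp add: mult_right_mono)
      also have "\<dots> = exp (g * real n)" by (simp add: g_def algebra_simps flip: exp_add)
      also have "\<dots> \<le> exp (g * (B * sqrt L + 1))"
        using n(3) g by (simp add: mult_left_mono)
      also have "\<dots> = exp g * exp (g * B * sqrt L)" by (simp add: algebra_simps flip: exp_add)
      finally have "G * (real n * (K ^ n)\<^sup>2) \<le> G * exp g * exp (g * B * sqrt L)"
        using G by (simp add: mult.assoc)
      also have "\<dots> \<le> C * exp (C * sqrt L)"
        using C L by (intro mult_mono) (auto intro!: mult_right_mono)
      finally show "G * (real n * (K ^ n)\<^sup>2) \<le> C * exp (C * sqrt L)" .
    qed
    finally show ?thesis unfolding J_def .
  qed
  show ?thesis
    using C(1) main by blast
qed

section \<open>From eigenfunctions to chains\<close>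

lemma L2_01_mult_integrable:
  assumes "f \<in> L2_01" "g \<in> L2_01"
  shows "integrable leb01 (\<lambda>x. f x * g x)"
proof (rule Bochner_Integration.integrable_bound)
  show "integrable leb01 (\<lambda>x. (f x)\<^sup>2 + (g x)\<^sup>2)"
    using assms by (simp add: L2_01_def)
  show "(\<lambda>x. f x * g x) \<in> borel_measurable leb01"
    using assms by (intro borel_measurable_times) (simp_all add: L2_01_def)
  have "\<bar>f x * g x\<bar> \<le> (f x)\<^sup>2 + (g x)\<^sup>2" for x
  proof -
    have "2 * (\<bar>f x\<bar> * \<bar>g x\<bar>) \<le> (f x)\<^sup>2 + (g x)\<^sup>2"
      using sum_squares_bound[of "\<bar>f x\<bar>" "\<bar>g x\<bar>"] by (simp add: mult.assoc)
    moreover have "0 \<le> \<bar>f x\<bar> * \<bar>g x\<bar>" by simp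
    ultimately show ?thesis unfolding abs_mult by linarith
  qed
  then show "AE x in leb01. norm (f x * g x) \<le> norm ((f x)\<^sup>2 + (g x)\<^sup>2)"
    by (intro AE_I2) simp
qed

lemma orthonormal_sum_square:
  assumes hb: "Hilbert_basis_L2 \<Phi>" and S: "finite S" "S \<subseteq> {1..}"
  shows "integrable leb01 (\<lambda>x. (\<Sum>j\<in>S. b j * \<Phi> j x)\<^sup>2)"
    and "(\<integral>x. (\<Sum>j\<in>S. b j * \<Phi> j x)\<^sup>2 \<partial>leb01) = (\<Sum>j\<in>S. (b j)\<^sup>2)"
proof -
  have L2: "\<Phi> j \<in> L2_01" if "j \<in> S" for j
    using hb S that unfolding Hilbert_basis_L2_def by auto
  have on: "(\<integral>x. \<Phi> i x * \<Phi> j x \<partial>leb01) = (if i = j then 1 else 0)" if "i \<in> S" "j \<in> S" for i j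
  proof -
    have "1 \<le> i" "1 \<le> j" using S(2) that by auto
    then show ?thesis using hb unfolding Hilbert_basis_L2_def L2_inner_def by blast
  qed
  have eq: "(\<Sum>j\<in>S. b j * \<Phi> j x)\<^sup>2 = (\<Sum>i\<in>S. \<Sum>j\<in>S. b i * b j * (\<Phi> i x * \<Phi> j x))" for x
    unfolding power2_eq_square sum_product by (intro sum.cong refl) simp
  have int: "integrable leb01 (\<lambda>x. b i * b j * (\<Phi> i x * \<Phi> j x))" if "i \<in> S" "j \<in> S" for i j
    using L2_01_mult_integrable[OF L2 L2] that by (intro integrable_mult_right) auto
  show "integrable leb01 (\<lambda>x. (\<Sum>j\<in>S. b j * \<Phi> j x)\<^sup>2)"
    unfolding eq using int by (intro Bochner_Integration.integrable_sum) auto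
  have "(\<integral>x. (\<Sum>j\<in>S. b j * \<Phi> j x)\<^sup>2 \<partial>leb01) = (\<Sum>i\<in>S. \<Sum>j\<in>S. \<integral>x. b i * b j * (\<Phi> i x * \<Phi> j x) \<partial>leb01)"
    unfolding eq using int by (subst Bochner_Integration.integral_sum, auto intro!: Bochner_Integration.integrable_sum sum.cong Bochner_Integration.integral_sum)
  also have "\<dots> = (\<Sum>i\<in>S. \<Sum>j\<in>S. if i = j then b i * b j else 0)"
    by (intro sum.cong refl) (simp add: on)
  also have "\<dots> = (\<Sum>j\<in>S. (b j)\<^sup>2)"
    using S(1) by (simp add: sum.delta power2_eq_square)
  finally show "(\<integral>x. (\<Sum>j\<in>S. b j * \<Phi> j x)\<^sup>2 \<partial>leb01) = (\<Sum>j\<in>S. (b j)\<^sup>2)" .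
qed

text \<open>Orthonormality enters here: Pythagoras computes the norm of P^k u, and
  \<open>lam j ^ k\<close> is at most \<Lambda>^k because \<open>lam j\<close> is nonnegative.
  Derivatives and boundary conditions pass to finite sums termwise.\<close>

lemma eigenbasis_spectral_chain:
  assumes eb: "eigenbasis \<alpha> lam \<Phi>" and S: "finite S" "\<And>j. j \<in> S \<Longrightarrow> 1 \<le> j \<and> 0 \<le> lam j \<and> lam j \<le> \<Lambda>"
  shows "spectral_chain \<alpha> \<Lambda> (sqrt (\<Sum>j\<in>S. (a j)\<^sup>2))
           (\<lambda>k x. \<Sum>j\<in>S. a j * lam j ^ k * \<Phi> j x)
           (\<lambda>k x. \<Sum>j\<in>S. a j * lam j ^ k * flux \<alpha> (\<Phi> j) x)"
proof -
  have hb: "Hilbert_basis_L2 \<Phi>" using eb by (simp add: eigenbasis_def)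
  have dom: "\<Phi> j \<in> DomP \<alpha>" if "j \<in> S" for j
    using eb S(2)[OF that] by (simp add: eigenbasis_def)
  have S1: "S \<subseteq> {1..}" using S(2) by auto
  show ?thesis
    unfolding spectral_chain_def
  proof (intro conjI allI ballI)
    fix k and x :: real assume x: "x \<in> {0<..<1}"
    have "((\<lambda>x. \<Sum>j\<in>S. a j * lam j ^ k * \<Phi> j x) has_real_derivative
        (\<Sum>j\<in>S. a j * lam j ^ k * (x powr (-\<alpha>) * flux \<alpha> (\<Phi> j) x))) (at x)"
      using S(2) by (intro DERIV_sum DERIV_cmult eigenfunction_classical(1)[OF eb _ x]) auto
    then show "((\<lambda>x. \<Sum>j\<in>S. a j * lam j ^ k * \<Phi> j x) has_real_derivative
        x powr (-\<alpha>) * (\<Sum>j\<in>S. a j * lam j ^ k * flux \<alpha> (\<Phi> j) x)) (at x)"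
      by (simp add: sum_distrib_left mult_ac)
    have "((\<lambda>x. \<Sum>j\<in>S. a j * lam j ^ k * flux \<alpha> (\<Phi> j) x) has_real_derivative
        (\<Sum>j\<in>S. a j * lam j ^ k * - (lam j * \<Phi> j x))) (at x)"
      using S(2) by (intro DERIV_sum DERIV_cmult eigenfunction_classical(2)[OF eb _ x]) auto
    then show "((\<lambda>x. \<Sum>j\<in>S. a j * lam j ^ k * flux \<alpha> (\<Phi> j) x) has_real_derivative
        - (\<Sum>j\<in>S. a j * lam j ^ Suc k * \<Phi> j x)) (at x)"
      by (simp add: sum_negf mult_ac)
  next
    fix k
    have "((\<lambda>x. \<Sum>j\<in>S. a j * lam j ^ k * \<Phi> j x) \<longlongrightarrow> (\<Sum>j\<in>S. a j * lam j ^ k * 0)) (at_left 1)"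
      using dom by (intro tendsto_sum tendsto_mult tendsto_const) (auto simp: DomP_def H1_def)
    then show "((\<lambda>x. \<Sum>j\<in>S. a j * lam j ^ k * \<Phi> j x) \<longlongrightarrow> 0) (at_left 1)" by simp
  next
    fix k
    have bc: "BC_zero \<alpha> (\<Phi> j)" if "j \<in> S" for j using dom[OF that] by (simp add: DomP_def)
    show "if \<alpha> < 1 then ((\<lambda>x. \<Sum>j\<in>S. a j * lam j ^ k * \<Phi> j x) \<longlongrightarrow> 0) (at_right 0)
          else ((\<lambda>x. \<Sum>j\<in>S. a j * lam j ^ k * flux \<alpha> (\<Phi> j) x) \<longlongrightarrow> 0) (at_right 0)"
    proof (cases "\<alpha> < 1")
      case True
      have "((\<lambda>x. \<Sum>j\<in>S. a j * lam j ^ k * \<Phi> j x) \<longlongrightarrow> (\<Sum>j\<in>S. a j * lam j ^ k * 0)) (at_right 0)"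
        using bc True by (intro tendsto_sum tendsto_mult tendsto_const) (auto simp: BC_zero_def)
      then show ?thesis using True by simp
    next
      case False
      have "((\<lambda>x. \<Sum>j\<in>S. a j * lam j ^ k * flux \<alpha> (\<Phi> j) x) \<longlongrightarrow> (\<Sum>j\<in>S. a j * lam j ^ k * 0)) (at_right 0)"
        using bc False by (intro tendsto_sum tendsto_mult tendsto_const) (auto simp: BC_zero_def)
      then show ?thesis using False by simp
    qed
  next
    fix k
    show "integrable leb01 (\<lambda>x. (\<Sum>j\<in>S. a j * lam j ^ k * \<Phi> j x)\<^sup>2)"
      by (rule orthonormal_sum_square(1)[OF hb S(1) S1])
    have "(\<integral>x. (\<Sum>j\<in>S. a j * lam j ^ k * \<Phi> j x)\<^sup>2 \<partial>leb01) = (\<Sum>j\<in>S. (a j * lam j ^ k)\<^sup>2)"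
      by (rule orthonormal_sum_square(2)[OF hb S(1) S1])
    also have "\<dots> \<le> (\<Sum>j\<in>S. (a j)\<^sup>2 * (\<Lambda> ^ k)\<^sup>2)"
      unfolding power_mult_distrib using S(2) by (intro sum_mono mult_left_mono power_mono) auto
    also have "\<dots> = (sqrt (\<Sum>j\<in>S. (a j)\<^sup>2) * \<Lambda> ^ k)\<^sup>2"
      by (simp add: power_mult_distrib sum_nonneg flip: sum_distrib_right)
    finally show "(\<integral>x. (\<Sum>j\<in>S. a j * lam j ^ k * \<Phi> j x)\<^sup>2 \<partial>leb01) \<le> (sqrt (\<Sum>j\<in>S. (a j)\<^sup>2) * \<Lambda> ^ k)\<^sup>2" .
  qed
qed

theorem theorem1p1:
  fixes \<alpha> \<sigma> \<gamma> :: real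
    and \<omega> :: "real set"
    and lam :: "nat \<Rightarrow> real"
    and \<Phi> :: "nat \<Rightarrow> real \<Rightarrow> real"
  assumes "0 < \<alpha>" and "\<alpha> < 2"
    and "eigenbasis \<alpha> lam \<Phi>"
    and "open \<omega>" and "\<omega> \<noteq> {}" and "\<omega> \<subseteq> {0<..<1}"
    and "\<alpha> \<noteq> 1 \<Longrightarrow> \<sigma> = 3 / 4"
    and "\<alpha> = 1 \<Longrightarrow> \<gamma> \<in> {0<..<2} \<and> 3 / (2 * \<gamma>) \<in> {0<..<1} \<and> \<sigma> = 3 / (2 * \<gamma>)"
  shows "\<exists>C>0. \<forall>(a :: nat \<Rightarrow> real) \<Lambda>. \<Lambda> > 0 \<longrightarrow>
           (\<Sum>j\<in>{j. 1 \<le> j \<and> lam j \<le> \<Lambda>}. \<bar>a j\<bar>\<^sup>2)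
             \<le> C * exp (C * \<Lambda> powr \<sigma>) *
                (\<integral>x\<in>\<omega>. \<bar>\<Sum>j\<in>{j. 1 \<le> j \<and> lam j \<le> \<Lambda>}. a j * \<Phi> j x\<bar>\<^sup>2 \<partial>lebesgue)"
proof -
  \<comment> \<open>For \<alpha> = 1 the condition \<gamma> < 2 even gives \<sigma> > 3/4.\<close>
  have \<sigma>: "1/2 \<le> \<sigma>"
  proof (cases "\<alpha> = 1")
    case True
    then have "0 < \<gamma>" "\<gamma> < 2" "\<sigma> = 3 / (2 * \<gamma>)" using assms(8) by auto
    then show ?thesis by (simp add: le_divide_eq)
  qed (simp add: assms(7))
  note eb = assms(3)
  have hb: "Hilbert_basis_L2 \<Phi>" using eb by (simp add: eigenbasis_def)
  have lam: "lam 1 \<le> lam j" if "1 \<le> j" for j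
    using that
  proof (induction j rule: nat_induct_at_least)
    case (Suc n)
    then show ?case using eb unfolding eigenbasis_def by (meson order_trans)
  qed simp
  have lam1: "0 < lam 1" using eb by (simp add: eigenbasis_def)
  \<comment> \<open>A sum over an infinite set is 0 by convention, so this is what gives the sums of
    the statement their intended meaning.\<close>
  have fin: "finite {j. 1 \<le> j \<and> lam j \<le> \<Lambda>}" for \<Lambda>
  proof -
    have "eventually (\<lambda>j. \<Lambda> < lam j) sequentially"
      using eb unfolding eigenbasis_def filterlim_at_top_dense by blast
    then obtain N where N: "\<And>j. j \<ge> N \<Longrightarrow> \<Lambda> < lam j"
      by (auto simp: eventually_sequentially)
    have "{j. 1 \<le> j \<and> lam j \<le> \<Lambda>} \<subseteq> {..<N}"
    proof
      fix j assume "j \<in> {j. 1 \<le> j \<and> lam j \<le> \<Lambda>}"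
      then show "j \<in> {..<N}" using N[of j] by (cases "N \<le> j") auto
    qed
    then show ?thesis by (rule finite_subset) simp
  qed
  obtain x0 where "x0 \<in> \<omega>" using assms(5) by blast
  then obtain r where r: "0 < r" "cball x0 r \<subseteq> \<omega>"
    using assms(4) open_contains_cball by blast
  define a' b' where "a' = x0 - r" and "b' = x0 + r"
  have cb: "cball x0 r = {a'..b'}" by (auto simp: a'_def b'_def dist_real_def)
  have "a' \<in> \<omega>" "b' \<in> \<omega>" using r unfolding cb by (auto simp: a'_def b'_def)
  then have ab: "0 < a'" "a' < b'" "b' < 1" "{a'..b'} \<subseteq> \<omega>"
    using assms(6) r unfolding cb by (auto simp: a'_def b'_def)
  obtain C where C: "0 < C" and obs: "\<And>L A u p. 0 < L \<Longrightarrow> 0 \<le> A \<Longrightarrow> spectral_chain \<alpha> L A u p \<Longrightarrow>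
      A\<^sup>2 \<le> (\<integral>x. (u 0 x)\<^sup>2 \<partial>leb01) \<Longrightarrow> set_integrable lebesgue \<omega> (\<lambda>x. (u 0 x)\<^sup>2) \<Longrightarrow>
      A\<^sup>2 \<le> C * exp (C * sqrt L) * (LINT x:\<omega>|lebesgue. (u 0 x)\<^sup>2)"
    using spectral_chain_observability[OF assms(1,2) ab] by blast
  \<comment> \<open>sqrt \<Lambda> is \<Lambda>^(1/2-\<sigma>) \<Lambda>^\<sigma> with 1/2-\<sigma>
    \<le> 0, so for \<Lambda> \<ge> \<open>lam 1\<close> the first factor is largest at
    \<open>lam 1\<close>.\<close>
  define D where "D = C * max 1 (lam 1 powr (1/2 - \<sigma>))"
  have D: "C \<le> D" "C * lam 1 powr (1/2 - \<sigma>) \<le> D"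
    using C unfolding D_def by (simp_all add: mult_left_mono mult_le_cancel_left1)
  have "0 < D" using C D by linarith
  show ?thesis
  proof (intro exI[of _ D] conjI \<open>0 < D\<close> allI impI)
    fix a :: "nat \<Rightarrow> real" and \<Lambda> :: real assume \<Lambda>: "\<Lambda> > 0"
    define S where "S = {j. 1 \<le> j \<and> lam j \<le> \<Lambda>}"
    define u where "u k x = (\<Sum>j\<in>S. a j * lam j ^ k * \<Phi> j x)" for k x
    define J where "J = (LINT x:\<omega>|lebesgue. (u 0 x)\<^sup>2)"
    have "0 \<le> J"
      unfolding J_def set_lebesgue_integral_def by (intro Bochner_Integration.integral_nonneg) (simp add: indicator_def)
    have finS: "finite S" unfolding S_def by (rule fin)
    have goal: "(\<Sum>j\<in>S. (a j)\<^sup>2) \<le> D * exp (D * \<Lambda> powr \<sigma>) * J"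
    proof (cases "S = {}")
      \<comment> \<open>This covers \<Lambda> < \<open>lam 1\<close>, where C sqrt \<Lambda> need
        not be at most D \<Lambda>^\<sigma>.\<close>
      case True
      then show ?thesis using \<open>0 < D\<close> \<open>0 \<le> J\<close> by simp
    next
      case False
      then obtain j where "1 \<le> j" "lam j \<le> \<Lambda>" by (auto simp: S_def)
      then have l1: "lam 1 \<le> \<Lambda>" using lam[of j] by linarith
      define A where "A = sqrt (\<Sum>j\<in>S. (a j)\<^sup>2)"
      have A: "0 \<le> A" "A\<^sup>2 = (\<Sum>j\<in>S. (a j)\<^sup>2)" by (simp_all add: A_def sum_nonneg)
      have "1 \<le> j \<and> 0 \<le> lam j \<and> lam j \<le> \<Lambda>" if "j \<in> S" for j
        using that lam[of j] lam1 by (auto simp: S_def)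
      from eigenbasis_spectral_chain[OF eb finS this, of a]
      have ch: "spectral_chain \<alpha> \<Lambda> A u (\<lambda>k x. \<Sum>j\<in>S. a j * lam j ^ k * flux \<alpha> (\<Phi> j) x)"
        unfolding A_def u_def by blast
      have S1: "S \<subseteq> {1..}" by (auto simp: S_def)
      have "A\<^sup>2 = (\<integral>x. (u 0 x)\<^sup>2 \<partial>leb01)"
        using orthonormal_sum_square(2)[OF hb finS S1, of a] by (simp add: A(2) u_def)
      moreover have "set_integrable lebesgue {0<..<1} (\<lambda>x. (u 0 x)\<^sup>2)"
        using spectral_chainD(6)[OF ch, of 0] unfolding set_integrable_def
        by (subst (asm) integrable_restrict_space) auto
      then have "set_integrable lebesgue \<omega> (\<lambda>x. (u 0 x)\<^sup>2)"
        by (rule set_integrable_subset) (use assms(4,6) in auto)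
      ultimately have "A\<^sup>2 \<le> C * exp (C * sqrt \<Lambda>) * J"
        unfolding J_def using obs[OF \<Lambda> A(1) ch] by simp
      also have "\<dots> \<le> D * exp (D * \<Lambda> powr \<sigma>) * J"
      proof (intro mult_right_mono mult_mono \<open>0 \<le> J\<close>)
        have "sqrt \<Lambda> = \<Lambda> powr (1/2 - \<sigma>) * \<Lambda> powr \<sigma>"
          using \<Lambda> by (simp add: powr_half_sqrt flip: powr_add)
        also have "\<dots> \<le> lam 1 powr (1/2 - \<sigma>) * \<Lambda> powr \<sigma>"
          using l1 lam1 \<sigma> by (intro mult_right_mono powr_mono2') auto
        finally have "C * sqrt \<Lambda> \<le> C * lam 1 powr (1/2 - \<sigma>) * \<Lambda> powr \<sigma>"
          using C by (simp add: mult.assoc)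
        also have "\<dots> \<le> D * \<Lambda> powr \<sigma>" using D(2) by (intro mult_right_mono) auto
        finally show "exp (C * sqrt \<Lambda>) \<le> exp (D * \<Lambda> powr \<sigma>)" by simp
      qed (use C D in auto)
      finally show ?thesis by (simp add: A(2))
    qed
    then show "(\<Sum>j\<in>{j. 1 \<le> j \<and> lam j \<le> \<Lambda>}. \<bar>a j\<bar>\<^sup>2)
             \<le> D * exp (D * \<Lambda> powr \<sigma>) *
                (\<integral>x\<in>\<omega>. \<bar>\<Sum>j\<in>{j. 1 \<le> j \<and> lam j \<le> \<Lambda>}. a j * \<Phi> j x\<bar>\<^sup>2 \<partial>lebesgue)"
      by (simp add: J_def u_def S_def)
  qed
qed

end
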